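(* Let $X\subset\mathbb Z^n$ be a finite digital image with $c_1$-adjacency, where $n\le4$, and let $f:X\to X$ be continuous with $|\bar L(f)|=k$. Then there are at least $k$ distinct elementary cubes $\sigma\subseteq X$ with $f(\sigma)=\sigma$.
   Context: On $\mathbb Z^n$, the $c_1$-adjacency declares two points adjacent iff they differ by $\pm1$ in exactly one coordinate and agree in all others. Write $x\leftrightarrow y$ for adjacent and $x\Leftrightarrow y$ for adjacent or equal; a map is continuous if $x\leftrightarrow y$ implies $f(x)\Leftrightarrow f(y)$. Cubical homology: an elementary interval is $\{a,a+1\}$ (nondegenerate) or $\{a\}$ (degenerate), $a\in\mathbb Z$; an elementary cube is $\sigma=t_1\times\dots\times t_n$ with each $t_i$ an elementary interval, and its dimension $q$ is the number of nondegenerate factors. $\bar C_q(X)$ is the free abelian group on the elementary $q$-cubes contained in $X$. With $A_i\sigma$ (resp. $B_i\sigma$) obtained by replacing $t_i$ by $\{\min t_i\}$ (resp. $\{\max t_i\}$), and $j_1<\dots<j_q$ the indices of nondegenerate factors, $\partial\sigma=\sum_{i=1}^q(-1)^i(A_{j_i}\sigma-B_{j_i}\sigma)$; $\bar H_q(X)$ is the homology. For continuous $f:X\to X$, define $\bar f_q(\sigma)=0$ if $f(\sigma)$ is not an elementary $q$-cube; otherwise $\tau=f(\sigma)$ is a $q$-cube, and identifying $\sigma$ and $\tau$ with $\{0,1\}^q$ via their nondegenerate coordinates (in increasing order, shifted by their minima), $f|_\sigma$ has the form $(x_1,\dots,x_q)\mapsto(y_1,\dots,y_q)$ with each $y_i\in\{x_{\pi(i)},1-x_{\pi(i)}\}$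 for a permutation $\pi$; set $\bar f_q(\sigma)=\operatorname{sgn}(\pi)(-1)^r\tau$, where $r$ is the number of $i$ with $y_i=1-x_{\pi(i)}$. It is known that for $n\le4$ these $\bar f_q$ form a chain map, inducing $\bar f_{*,q}$ on $\bar H_q(X)$. The cubical Lefschetz number is $\bar L(f)=\sum_{q\ge0}(-1)^q\operatorname{tr}(\bar f_{*,q})$, traces taken on $\bar H_q(X)\otimes\mathbb Q$. *)

theory Defs
  imports Complex_Main "HOL-Combinatorics.Permutations"
begin

type_synonym point = "int list"
type_synonym ecube = "(int \<times> int) list"  \<comment> \<open>list of elementary intervals (min, max), max = min or min+1\<close>

definition c1_adj :: "point \<Rightarrow> point \<Rightarrow> bool" where
  "c1_adj x y \<longleftrightarrow> length x = length y \<and>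
     (\<exists>i<length x. \<bar>x!i - y!i\<bar> = 1 \<and> (\<forall>j<length x. j \<noteq> i \<longrightarrow> x!j = y!j))"

definition c1_continuous :: "point set \<Rightarrow> (point \<Rightarrow> point) \<Rightarrow> bool" where
  "c1_continuous X f \<longleftrightarrow> f ` X \<subseteq> X \<and>
     (\<forall>x\<in>X. \<forall>y\<in>X. c1_adj x y \<longrightarrow> (f x = f y \<or> c1_adj (f x) (f y)))"

definition cpts :: "ecube \<Rightarrow> point set" where
  "cpts c = {x. length x = length c \<and> (\<forall>i<length c. fst (c!i) \<le> x!i \<and> x!i \<le> snd (c!i))}"

text \<open>indices of nondegenerate factors, in increasing order\<close>
definition nd :: "ecube \<Rightarrow> nat list" where
  "nd c = filter (\<lambda>i. snd (c!i) \<noteq> fst (c!i)) [0..<length c]"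

definition cdim :: "ecube \<Rightarrow> nat" where
  "cdim c = length (nd c)"

definition elem_cube :: "nat \<Rightarrow> ecube \<Rightarrow> bool" where
  "elem_cube n c \<longleftrightarrow> length c = n \<and> (\<forall>i<n. snd (c!i) = fst (c!i) \<or> snd (c!i) = fst (c!i) + 1)"

text \<open>elementary q-cubes of Z^n contained in X\<close>
definition cubes :: "point set \<Rightarrow> nat \<Rightarrow> nat \<Rightarrow> ecube set" where
  "cubes X n q = {c. elem_cube n c \<and> cdim c = q \<and> cpts c \<subseteq> X}"

definition all_cubes :: "point set \<Rightarrow> nat \<Rightarrow> ecube set" where
  "all_cubes X n = {c. elem_cube n c \<and> cpts c \<subseteq> X}"

text \<open>chains with rat coefficients supported on the q-cubes of X\<close>
definition chains :: "point set \<Rightarrow> nat \<Rightarrow> nat \<Rightarrow> (ecube \<Rightarrow> rat) set" where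
  "chains X n q = {v. \<forall>s. s \<notin> cubes X n q \<longrightarrow> v s = 0}"

text \<open>coefficient of t in the boundary of s:
  sum over i=1..q of (-1)^i (A_{j_i} s - B_{j_i} s)\<close>
definition bcoef :: "ecube \<Rightarrow> ecube \<Rightarrow> rat" where
  "bcoef s t = (\<Sum>i<length (nd s). (-1)^(i+1) *
      ((if s[nd s ! i := (fst (s ! (nd s ! i)), fst (s ! (nd s ! i)))] = t then 1 else 0)
     - (if s[nd s ! i := (snd (s ! (nd s ! i)), snd (s ! (nd s ! i)))] = t then 1 else 0)))"

definition bdry :: "point set \<Rightarrow> nat \<Rightarrow> nat \<Rightarrow> (ecube \<Rightarrow> rat) \<Rightarrow> (ecube \<Rightarrow> rat)" where
  "bdry X n q v = (\<lambda>t. \<Sum>s\<in>cubes X n q. v s * bcoef s t)"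

definition cycles :: "point set \<Rightarrow> nat \<Rightarrow> nat \<Rightarrow> (ecube \<Rightarrow> rat) set" where
  "cycles X n q = {v \<in> chains X n q. bdry X n q v = (\<lambda>_. 0)}"

definition boundaries :: "point set \<Rightarrow> nat \<Rightarrow> nat \<Rightarrow> (ecube \<Rightarrow> rat) set" where
  "boundaries X n q = bdry X n (Suc q) ` chains X n (Suc q)"

text \<open>vertex of the cube c with nondegenerate-coordinate vector x in {0,1}^q,
  encoded by the set S = {i. x_i = 1} \<subseteq> {..<q}\<close>
definition vertex :: "ecube \<Rightarrow> nat set \<Rightarrow> point" where
  "vertex c S = map (\<lambda>j. fst (c!j) + (if \<exists>i\<in>S. i < length (nd c) \<and> nd c ! i = j then 1 else 0))
                   [0..<length c]"

text \<open>coefficient of t in fbar_q(s): sgn(pi) (-1)^r if f(s) = t is an elementary q-cube and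
  f restricted to s is (x_1..x_q) |-> (y_1..y_q) with y_i = x_{pi i} or 1 - x_{pi i}
  (flipped exactly for i in E, r = card E); 0 otherwise.
  (pi, E) are unique when they exist, so the sum has at most one nonzero term.\<close>
definition fcoef :: "point set \<Rightarrow> nat \<Rightarrow> (point \<Rightarrow> point) \<Rightarrow> ecube \<Rightarrow> ecube \<Rightarrow> rat" where
  "fcoef X n f s t =
    (let q = cdim s in
     if t \<in> cubes X n q \<and> f ` cpts s = cpts t then
       (\<Sum>p\<in>{p. p permutes {..<q}}. \<Sum>E\<in>Pow {..<q}.
          if (\<forall>S\<in>Pow {..<q}. f (vertex s S) = vertex t {i. i < q \<and> ((i \<in> E) \<noteq> (p i \<in> S))})
          then of_int (sign p) * (-1) ^ card E else 0)
     else 0)"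

definition fchain :: "point set \<Rightarrow> nat \<Rightarrow> (point \<Rightarrow> point) \<Rightarrow> nat \<Rightarrow> (ecube \<Rightarrow> rat) \<Rightarrow> (ecube \<Rightarrow> rat)" where
  "fchain X n f q v = (\<lambda>t. \<Sum>s\<in>cubes X n q. v s * fcoef X n f s t)"

text \<open>linear algebra: trace of the map induced by g on the quotient Z/B\<close>
definition lincomb :: "(nat \<Rightarrow> rat) \<Rightarrow> ('a \<Rightarrow> rat) list \<Rightarrow> ('a \<Rightarrow> rat)" where
  "lincomb a bs = (\<lambda>x. \<Sum>i<length bs. a i * (bs ! i) x)"

definition quot_trace :: "(('a \<Rightarrow> rat) \<Rightarrow> ('a \<Rightarrow> rat)) \<Rightarrow> ('a \<Rightarrow> rat) set \<Rightarrow> ('a \<Rightarrow> rat) set \<Rightarrow> rat" where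
  "quot_trace g Z B = (SOME t. \<exists>bs M.
      set bs \<subseteq> Z \<and>
      (\<forall>a. lincomb a bs \<in> B \<longrightarrow> (\<forall>i<length bs. a i = 0)) \<and>
      (\<forall>z\<in>Z. \<exists>a. (\<lambda>x. z x - lincomb a bs x) \<in> B) \<and>
      (\<forall>i<length bs. (\<lambda>x. g (bs ! i) x - lincomb (M i) bs x) \<in> B) \<and>
      t = (\<Sum>i<length bs. M i i))"

text \<open>trace of fbar_{*,q} on H_q(X) (with rat coefficients)\<close>
definition hom_trace :: "point set \<Rightarrow> nat \<Rightarrow> (point \<Rightarrow> point) \<Rightarrow> nat \<Rightarrow> rat" where
  "hom_trace X n f q = quot_trace (fchain X n f q) (cycles X n q) (boundaries X n q)"

definition cub_lefschetz :: "point set \<Rightarrow> nat \<Rightarrow> (point \<Rightarrow> point) \<Rightarrow> rat" where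
  "cub_lefschetz X n f = (\<Sum>q\<le>n. (-1) ^ q * hom_trace X n f q)"

end

theory Submission
  imports Defs "Jordan_Normal_Form.Determinant"
begin

text \<open>
  By the Hopf trace formula the Lefschetz number is the
  alternating sum of the traces on the chain groups, and the trace on \<open>q\<close>-chains is a sum of signs
  over the \<open>q\<close>-cubes mapped onto themselves.

  This needs the chain map property. If \<open>f\<close> maps a cube \<open>s\<close> onto a cube, it is a signed permutation
  there and the signs on the facets are related to the sign on \<open>s\<close> by Laplace expansion. Otherwise
  the image of the boundary of \<open>s\<close> is, by induction, a cycle with at most as many cells as a
  \<open>q\<close>-cube has facets, namely \<open>2q\<close>. A nonzero \<open>(q - 1)\<close>-cycle of the integer grid has at least
  \<open>2q\<close> cells, and if there are exactly \<open>2q\<close> then they fill a \<open>q\<close>-cube; hence the image of \<open>s\<close> would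
  be a cube after all, so this cycle is zero.
\<close>

section \<open>Recursive description of the boundary\<close>

text \<open>The obstacle is that a continuous map can bend a cube: the four vertices of a square may
  go to the three points of an L-shaped path. Such images have no normal form, so these cubes are
  handled by counting the cells in the image of the boundary rather than by describing the image
  itself. The bound 2q comes from cutting a (q - 1)-cycle by a hyperplane at half-integral height.
  The slice is a cycle of one dimension less, with 2(q - 1) cells by induction, and at least one
  further cell lies on either side. In degree 0 every chain is a cycle, so there the cycle condition
  is replaced by the vanishing of the sum of the coefficients; slices of 1-cycles satisfy it because
  they are boundaries. Cutting is along the first coordinate, hence the boundary is recast as a
  recursion on the list of factors.\<close>

lemma nd_Nil [simp]: "nd [] = []"
  by (simp add: nd_def)

lemma nd_Cons: "nd (x # c) = (if snd x = fst x then [] else [0]) @ map Suc (nd c)"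
proof -
  have "[0..<length (x # c)] = 0 # map Suc [0..<length c]"
    by (simp add: upt_conv_Cons map_Suc_upt del: upt_Suc)
  then show ?thesis by (simp add: nd_def filter_map o_def)
qed

lemma cdim_Nil [simp]: "cdim [] = 0"
  by (simp add: cdim_def)

lemma cdim_Cons [simp]: "cdim (x # c) = (if snd x = fst x then 0 else 1) + cdim c"
  by (simp add: cdim_def nd_Cons)

lemma elem_cube_Nil [simp]: "elem_cube n [] \<longleftrightarrow> n = 0"
  by (auto simp: elem_cube_def)

lemma elem_cube_Cons:
  "elem_cube n (x # c) \<longleftrightarrow> (snd x = fst x \<or> snd x = fst x + 1) \<and> (\<exists>m. n = Suc m \<and> elem_cube m c)"
  unfolding elem_cube_def by (cases n) (auto simp: All_less_Suc2 simp del: all_simps)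

lemma elem_cube_0: "elem_cube 0 c \<longleftrightarrow> c = []"
  by (auto simp: elem_cube_def)

lemma Cons_in_cpts_iff [simp]:
  "y # ys \<in> cpts (x # c) \<longleftrightarrow> fst x \<le> y \<and> y \<le> snd x \<and> ys \<in> cpts c"
  by (auto simp: cpts_def All_less_Suc2)

lemma bcoef_Nil [simp]: "bcoef [] t = 0"
  by (simp add: bcoef_def)

lemma bcoef_Cons_Nil [simp]: "bcoef (x # s) [] = 0"
proof -
  have "(x # s)[i := y] \<noteq> []" for i y
    by (metis length_list_update list.size(3) list.distinct(1) length_0_conv)
  then show ?thesis unfolding bcoef_def by simp
qed

text \<open>Product rule for the boundary. A nondegenerate first factor is direction number 1 and
  carries the sign -1, so its upper end counts +1 and its lower end -1. It also shifts the numbers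
  of all other directions by one, whence the minus sign of the recursive term.\<close>

lemma bcoef_Cons_Cons:
  "bcoef (x # s) (y # t) =
    (if snd x = fst x then (if x = y then bcoef s t else 0)
     else (if (snd x, snd x) = y \<and> s = t then 1 else 0) - (if (fst x, fst x) = y \<and> s = t then 1 else 0)
       - (if x = y then bcoef s t else 0))"
proof (cases "snd x = fst x")
  case True
  then show ?thesis
    by (auto simp: bcoef_def nd_Cons intro!: sum.neutral sum.cong)
next
  case False
  then show ?thesis
    by (auto simp: bcoef_def nd_Cons sum.lessThan_Suc_shift sum_negf[symmetric]
        intro!: sum.neutral sum.cong simp del: sum.lessThan_Suc)
qed

text \<open>The boundary operator in transposed form: the coefficient at a cell is collected from
  the cells that have it as a facet. No sum over a support occurs, so layers
  \<open>\<lambda>s. c (x # s)\<close> split off by mere unfolding.\<close>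

primrec bd :: "(ecube \<Rightarrow> rat) \<Rightarrow> ecube \<Rightarrow> rat" where
  "bd c [] = 0"
| "bd c (x # t) =
    (if snd x = fst x
     then bd (\<lambda>s. c (x # s)) t + c ((fst x - 1, fst x) # t) - c ((fst x, fst x + 1) # t)
     else - bd (\<lambda>s. c (x # s)) t)"

lemma bd_zero [simp]: "bd (\<lambda>_. 0) t = 0"
  by (induction t) simp_all

lemma bd_add: "bd (\<lambda>s. c s + d s) t = bd c t + bd d t"
  by (induction t arbitrary: c d) simp_all

lemma bd_scale: "bd (\<lambda>s. x * c s) t = x * bd c t"
  by (induction t arbitrary: c) (simp_all add: algebra_simps)

lemma bd_minus: "bd (\<lambda>s. - c s) t = - bd c t"
  using bd_scale[of "-1" c t] by simp

lemma bd_diff: "bd (\<lambda>s. c s - d s) t = bd c t - bd d t"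
  using bd_add[of c "\<lambda>s. - d s" t] by (simp add: bd_minus)

lemma bd_sum: "bd (\<lambda>s. \<Sum>i\<in>I. c i s) t = (\<Sum>i\<in>I. bd (c i) t)"
  by (induction I rule: infinite_finite_induct) (simp_all add: bd_add)

text \<open>The mixed terms, with the first coordinate differentiated once, cancel because of the
  sign in the nondegenerate branch of \<open>bd\<close>; the remaining ones vanish by
  induction.\<close>

lemma bd_bd: "bd (bd c) t = 0"
  by (induction t arbitrary: c) (simp_all add: bd_add bd_diff bd_minus)

text \<open>Ties the recursion to the given incidence coefficients. \<open>bd\<close> only inspects
  the unit intervals on either side of a point, which is where \<open>elem_cube\<close>
  enters.\<close>

lemma bcoef_eq_bd: "elem_cube n s \<Longrightarrow> bcoef s t = bd (\<lambda>u. if u = s then 1 else 0) t"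
proof (induction s arbitrary: n t)
  case Nil
  have "bd (\<lambda>u. if u = [] then 1 else 0) t = 0"
    by (cases t) simp_all
  then show ?case by simp
next
  case (Cons x s)
  then obtain m where x: "snd x = fst x \<or> snd x = fst x + 1" and m: "elem_cube m s"
    by (auto simp: elem_cube_Cons)
  show ?case
  proof (cases t)
    case Nil
    then show ?thesis by simp
  next
    case (Cons y t')
    have "bd (\<lambda>u. if y = x \<and> u = s then 1 else 0) t' = (if y = x then bcoef s t' else 0)"
      using Cons.IH[OF m] by simp
    with x show ?thesis
      by (cases x; cases y) (auto simp: Cons bcoef_Cons_Cons)
  qed
qed

definition cubical_chain :: "nat \<Rightarrow> nat \<Rightarrow> (ecube \<Rightarrow> rat) \<Rightarrow> bool" where
  "cubical_chain n k c \<longleftrightarrow> finite {s. c s \<noteq> 0} \<and> (\<forall>s. c s \<noteq> 0 \<longrightarrow> elem_cube n s \<and> cdim s = k)"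

lemma bd_eq_sum_bcoef:
  assumes "finite S" and S: "\<And>s. c s \<noteq> 0 \<Longrightarrow> s \<in> S" and elem: "\<And>s. s \<in> S \<Longrightarrow> elem_cube n s"
  shows "bd c t = (\<Sum>s\<in>S. c s * bcoef s t)"
proof -
  have "c = (\<lambda>u. \<Sum>s\<in>S. c s * (if u = s then 1 else 0))"
    using S by (auto simp: fun_eq_iff if_distrib[of "\<lambda>x. _ * x"] sum.delta' \<open>finite S\<close> cong: if_cong)
  then have "bd c t = bd (\<lambda>u. \<Sum>s\<in>S. c s * (if u = s then 1 else 0)) t"
    by simp
  also have "\<dots> = (\<Sum>s\<in>S. c s * bcoef s t)"
    unfolding bd_sum bd_scale by (rule sum.cong) (simp_all add: bcoef_eq_bd[OF elem])
  finally show ?thesis .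
qed

text \<open>Every edge contributes +1 at one end and -1 at the other. This supplies the substitute
  for the cycle condition in degree 0.\<close>

lemma sum_bd_one_chain:
  assumes u: "cubical_chain n 1 u" and "finite R" and R: "{r. bd u r \<noteq> 0} \<subseteq> R"
  shows "(\<Sum>r\<in>R. bd u r) = 0"
proof -
  let ?S = "{s. u s \<noteq> 0}"
  let ?A = "\<lambda>s. s[nd s ! 0 := (fst (s ! (nd s ! 0)), fst (s ! (nd s ! 0)))]"
  let ?B = "\<lambda>s. s[nd s ! 0 := (snd (s ! (nd s ! 0)), snd (s ! (nd s ! 0)))]"
  \<comment> \<open>All end points are added to \<open>R\<close>, so that both terms of every edge
    are summed; outside \<open>R\<close> the boundary vanishes anyway.\<close>
  let ?R = "R \<union> ?A ` ?S \<union> ?B ` ?S"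
  have S: "finite ?S" "\<And>s. s \<in> ?S \<Longrightarrow> elem_cube n s" "\<And>s. s \<in> ?S \<Longrightarrow> length (nd s) = 1"
    using u by (auto simp: cubical_chain_def cdim_def)
  have fin: "finite ?R" using S(1) \<open>finite R\<close> by blast
  have "(\<Sum>r\<in>?R. bcoef s r) = 0" if "s \<in> ?S" for s
  proof -
    have "bcoef s r = (if ?B s = r then 1 else 0) - (if ?A s = r then 1 else 0)" for r
      using S(3)[OF that] by (simp add: bcoef_def)
    moreover have "?A s \<in> ?R" "?B s \<in> ?R" using that by blast+
    ultimately show ?thesis using fin by (simp add: sum_subtractf)
  qed
  then have "(\<Sum>s\<in>?S. u s * (\<Sum>r\<in>?R. bcoef s r)) = 0"
    by (intro sum.neutral) auto
  moreover have "(\<Sum>r\<in>?R. bd u r) = (\<Sum>s\<in>?S. u s * (\<Sum>r\<in>?R. bcoef s r))"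
    by (subst bd_eq_sum_bcoef[OF S(1) _ S(2)])
       (auto simp: sum_distrib_left intro: sum.swap)
  moreover have "(\<Sum>r\<in>R. bd u r) = (\<Sum>r\<in>?R. bd u r)"
    using R fin by (intro sum.mono_neutral_left) auto
  ultimately show ?thesis by simp
qed

section \<open>Cycles with few cells\<close>

lemma cubical_chain_finite: "cubical_chain n k c \<Longrightarrow> finite {s. c s \<noteq> 0}"
  by (simp add: cubical_chain_def)

lemma cubical_chain_card_pos:
  assumes "cubical_chain n k c" and "{s. c s \<noteq> 0} \<noteq> {}"
  shows "0 < card {s. c s \<noteq> 0}"
  using assms by (simp only: card_gt_0_iff cubical_chain_finite simp_thms)

lemma cubical_chain_elem:
  "cubical_chain n k c \<Longrightarrow> c s \<noteq> 0 \<Longrightarrow> elem_cube n s"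
  "cubical_chain n k c \<Longrightarrow> c s \<noteq> 0 \<Longrightarrow> cdim s = k"
  by (simp_all add: cubical_chain_def)

text \<open>Cut the cycle at height \<open>a + 1/2\<close> of the first coordinate: the slice is the negative of the
  boundary of the part \<open>u\<close> above the cut, projected along the first coordinate, and the part below
  the cut is nonempty for the same reason.\<close>
lemma cycle_slice:
  assumes c: "cubical_chain (Suc n) (Suc k) c" and cyc: "\<And>t. bd c t = 0"
    and r0: "c ((a, a + 1) # r0) \<noteq> 0"
  obtains u where "cubical_chain n (Suc k) u"
    and "\<And>r. bd u r = - c ((a, a + 1) # r)"
    and "{r. u r \<noteq> 0} \<noteq> {}"
    and "card {r. c ((a, a + 1) # r) \<noteq> 0} + card {r. u r \<noteq> 0} + 1 \<le> card {s. c s \<noteq> 0}"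
proof -
  let ?S = "{s. c s \<noteq> 0}"
  have fin: "finite ?S" using c by (simp add: cubical_chain_def)
  have elem: "elem_cube (Suc n) s \<and> cdim s = Suc k" if "c s \<noteq> 0" for s
    using c that by (simp add: cubical_chain_def)
  \<comment> \<open>The cycle condition at flat cells: the boundary of the layer at height
    \<open>b\<close> is the slab above it minus the slab below it.\<close>
  have deg: "bd (\<lambda>s. c ((b, b) # s)) r = c ((b, b + 1) # r) - c ((b - 1, b) # r)" for b r
    using cyc[of "(b, b) # r"] by simp
  \<comment> \<open>All cells begin at a first coordinate nearer to \<open>a\<close> than
    \<open>m\<close>, so the slabs at distance \<open>m\<close> are empty and the telescoping sums
    below end in 0.\<close>
  obtain m where m: "\<And>s. c s \<noteq> 0 \<Longrightarrow> nat \<bar>fst (hd s) - a\<bar> < m"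
    using finite_nat_set_iff_bounded[of "(\<lambda>s. nat \<bar>fst (hd s) - a\<bar>) ` ?S"] fin by auto
  have far: "c ((b, d) # r) = 0" if "int m \<le> \<bar>b - a\<bar>" for b d r
    using m[of "(b, d) # r"] that by (cases "c ((b, d) # r) = 0") auto
  \<comment> \<open>The layers above the cut are added up after forgetting their heights;
    \<open>w\<close> does the same for the layers at heights at most \<open>a\<close>.\<close>
  define u where "u r = (\<Sum>i<m. c ((a + 1 + int i, a + 1 + int i) # r))" for r
  define w where "w r = (\<Sum>i<m. c ((a - int i, a - int i) # r))" for r
  have bd_u: "bd u r = - c ((a, a + 1) # r)" for r
  proof -
    let ?h = "\<lambda>i. c ((a + int i, a + int i + 1) # r)"
    have "bd u r = (\<Sum>i<m. ?h (Suc i) - ?h i)"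
      unfolding u_def bd_sum deg by (rule sum.cong) (simp_all add: add.commute add.left_commute)
    also have "\<dots> = ?h m - ?h 0" by (rule sum_lessThan_telescope)
    finally show ?thesis using far[of "a + int m"] by simp
  qed
  have bd_w: "bd w r = c ((a, a + 1) # r)" for r
  proof -
    let ?h = "\<lambda>i. - c ((a - int i, a - int i + 1) # r)"
    have "bd w r = (\<Sum>i<m. ?h (Suc i) - ?h i)"
      unfolding w_def bd_sum deg by (rule sum.cong) (simp_all add: diff_diff_eq add.commute)
    also have "\<dots> = ?h m - ?h 0" by (rule sum_lessThan_telescope)
    finally show ?thesis using far[of "a - int m"] by simp
  qed
  let ?U = "{s \<in> ?S. \<exists>b r. s = (b, b) # r \<and> a < b}"
  let ?L = "{s \<in> ?S. \<exists>b r. s = (b, b) # r \<and> b \<le> a}"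
  let ?M = "Cons (a, a + 1) ` {r. c ((a, a + 1) # r) \<noteq> 0}"
  have u_sub: "{r. u r \<noteq> 0} \<subseteq> tl ` ?U"
  proof
    fix r assume "r \<in> {r. u r \<noteq> 0}"
    then obtain i where "c ((a + 1 + int i, a + 1 + int i) # r) \<noteq> 0"
      unfolding u_def using sum.not_neutral_contains_not_neutral by blast
    then show "r \<in> tl ` ?U" by (intro image_eqI[of _ _ "(a + 1 + int i, a + 1 + int i) # r"]) auto
  qed
  have finU: "finite ?U" using fin by simp
  have "cubical_chain n (Suc k) u"
    unfolding cubical_chain_def
  proof (intro conjI allI impI)
    show "finite {r. u r \<noteq> 0}" using u_sub finU finite_subset by blast
    fix r assume "u r \<noteq> 0"
    then obtain b where "c ((b, b) # r) \<noteq> 0" using u_sub by auto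
    from elem[OF this] show "elem_cube n r" "cdim r = Suc k"
      by (auto simp: elem_cube_Cons)
  qed
  moreover have "{r. u r \<noteq> 0} \<noteq> {}"
  proof
    assume "{r. u r \<noteq> 0} = {}"
    then have "u = (\<lambda>_. 0)" by auto
    with bd_u[of r0] r0 show False by simp
  qed
  moreover have "card {r. c ((a, a + 1) # r) \<noteq> 0} + card {r. u r \<noteq> 0} + 1 \<le> card ?S"
  proof -
    \<comment> \<open>Slab cells, flat cells above the cut and flat cells below it are disjoint
      families. Projection may merge or cancel cells, so \<open>u\<close> has at most as many cells
      as the family above. The summand 1 is a cell below, which exists because \<open>w\<close> is
      nonzero.\<close>
    have "w \<noteq> (\<lambda>_. 0)" using bd_w[of r0] r0 by auto
    then obtain r where "w r \<noteq> 0" by blast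
    then obtain i where "c ((a - int i, a - int i) # r) \<noteq> 0"
      unfolding w_def using sum.not_neutral_contains_not_neutral by blast
    then have "(a - int i, a - int i) # r \<in> ?L" by auto
    then have "?L \<noteq> {}" by (rule ex_in_conv[THEN iffD1, OF exI])
    moreover have finL: "finite ?L" using fin by simp
    ultimately have "0 < card ?L" by (rule card_gt_0_iff[THEN iffD2, OF conjI])
    have U: "card {r. u r \<noteq> 0} \<le> card ?U"
      using card_mono[OF finite_imageI[OF finU] u_sub] card_image_le[OF finU] le_trans by blast
    have M: "card ?M = card {r. c ((a, a + 1) # r) \<noteq> 0}"
      by (rule card_image) (simp add: inj_on_def)
    have finM: "finite ?M" by (rule finite_subset[OF _ fin]) auto
    have "?M \<inter> ?U = {}" "(?M \<union> ?U) \<inter> ?L = {}" by auto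
    then have "card (?M \<union> ?U \<union> ?L) = card ?M + card ?U + card ?L"
      by (simp only: card_Un_disjoint finM finU finL finite_UnI)
    moreover have "card (?M \<union> ?U \<union> ?L) \<le> card ?S"
      by (rule card_mono[OF fin]) auto
    ultimately show ?thesis using \<open>0 < card ?L\<close> U M by linarith
  qed
  ultimately show ?thesis using that bd_u by blast
qed

lemma cubical_chain_Cons:
  assumes "cubical_chain (Suc n) k c"
  shows "cubical_chain n (k - (if snd x = fst x then 0 else 1)) (\<lambda>r. c (x # r))"
  unfolding cubical_chain_def
proof (intro conjI allI impI)
  have "finite {s. c s \<noteq> 0}" using assms by (simp add: cubical_chain_def)
  then have "finite (tl ` {s. c s \<noteq> 0})" by (rule finite_imageI)
  then show "finite {r. c (x # r) \<noteq> 0}"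
  proof (rule finite_subset[rotated], intro subsetI)
    fix r assume "r \<in> {r. c (x # r) \<noteq> 0}"
    then show "r \<in> tl ` {s. c s \<noteq> 0}" by (intro image_eqI[of _ _ "x # r"]) simp_all
  qed
  fix r assume "c (x # r) \<noteq> 0"
  then have "elem_cube (Suc n) (x # r)" "cdim (x # r) = k"
    using assms by (auto simp: cubical_chain_def)
  then show "elem_cube n r" "cdim r = k - (if snd x = fst x then 0 else 1)"
    by (auto simp: elem_cube_Cons split: if_splits)
qed

text \<open>The case split behind both inductions on the ambient dimension: a chain that crosses a
  slab is cut there, any other chain is replaced by one of its layers of constant first
  coordinate.\<close>

lemma nonzero_chain_cases:
  assumes c: "cubical_chain (Suc n) k c" and "c \<noteq> (\<lambda>_. 0)"
  obtains (slice) a r where "c ((a, a + 1) # r) \<noteq> 0"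
  | (flat) a r where "\<And>a r. c ((a, a + 1) # r) = 0" and "c ((a, a) # r) \<noteq> 0"
proof (cases "\<exists>a r. c ((a, a + 1) # r) \<noteq> 0")
  case False
  obtain s where s: "c s \<noteq> 0" using assms(2) by auto
  then have "elem_cube (Suc n) s" using c by (simp add: cubical_chain_def)
  then obtain a b r where "s = (a, b) # r" "b = a \<or> b = a + 1"
    by (cases s) (auto simp: elem_cube_Cons)
  with False s show ?thesis by (intro flat[of a r]) auto
qed (use slice in blast)

lemma slice_is_cycle:
  assumes "\<And>t. bd c t = 0"
  shows "bd (\<lambda>r. c ((a, a + 1) # r)) t = 0"
  using assms[of "(a, a + 1) # t"] by simp

text \<open>Without slabs, layers at different heights have no boundary cell in common, so each of
  them is a cycle by itself.\<close>

lemma flat_part_is_cycle: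
  assumes "\<And>t. bd c t = 0" and "\<And>a r. c ((a, a + 1) # r) = 0"
  shows "bd (\<lambda>r. c ((a, a) # r)) t = 0"
  using assms(1)[of "(a, a) # t"] assms(2)[of "a - 1" t] assms(2)[of a t] by simp

lemma card_flat_part_le:
  assumes "cubical_chain n k c"
  shows "card {r. c (x # r) \<noteq> 0} \<le> card {s. c s \<noteq> 0}"
  using assms by (intro card_inj_on_le[of "Cons x"]) (auto simp: cubical_chain_def)

text \<open>Passing to a layer keeps the degree and passing to a slice lowers it, but both lose one
  coordinate; hence the induction on the ambient dimension. In degree 0 a single cell is excluded
  since one nonzero coefficient cannot sum to zero.\<close>

lemma card_support_cycle_ge:
  assumes "cubical_chain n k c" "\<And>t. bd c t = 0" "c \<noteq> (\<lambda>_. 0)"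
    and "k = 0 \<Longrightarrow> (\<Sum>s\<in>{s. c s \<noteq> 0}. c s) = 0"
  shows "2 * Suc k \<le> card {s. c s \<noteq> 0}"
  using assms
proof (induction n arbitrary: k c)
  case 0
  then have "s = []" if "c s \<noteq> 0" for s
    using cubical_chain_elem(1)[OF "0.prems"(1) that] by (simp add: elem_cube_0)
  moreover obtain s where "c s \<noteq> 0" using 0 by auto
  ultimately have "{s. c s \<noteq> 0} = {[]}" "c [] \<noteq> 0" by auto
  moreover have "k = 0" using cubical_chain_elem(2)[OF "0.prems"(1) \<open>c [] \<noteq> 0\<close>] by simp
  ultimately show ?case using "0.prems"(4) by simp
next
  case (Suc n)
  show ?case
  proof (cases k)
    case 0
    let ?S = "{s. c s \<noteq> 0}"
    have fin: "finite ?S" using Suc.prems(1) by (simp add: cubical_chain_def)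
    obtain s where s: "s \<in> ?S" using Suc.prems(3) by auto
    have rest: "(\<Sum>t\<in>?S - {s}. c t) = - c s"
      using sum.remove[OF fin s, of c] Suc.prems(4)[OF 0] by simp
    have "?S - {s} \<noteq> {}"
    proof
      assume empty: "?S - {s} = {}"
      show False using rest s unfolding empty by simp
    qed
    then obtain t where t: "t \<in> ?S" "t \<noteq> s" by blast
    have "card {s, t} \<le> card ?S" by (rule card_mono[OF fin]) (use s t in auto)
    then show ?thesis using 0 t by simp
  next
    case (Suc k')
    from Suc.prems(1,3) show ?thesis
    proof (cases rule: nonzero_chain_cases)
      case (slice a r0)
      let ?d = "\<lambda>r. c ((a, a + 1) # r)"
      obtain u where u: "cubical_chain n (Suc k') u" "\<And>r. bd u r = - ?d r" "{r. u r \<noteq> 0} \<noteq> {}"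
        "card {r. ?d r \<noteq> 0} + card {r. u r \<noteq> 0} + 1 \<le> card {s. c s \<noteq> 0}"
        by (rule cycle_slice[OF Suc.prems(1)[unfolded Suc] Suc.prems(2) slice]) (rule that)
      have d: "cubical_chain n k' ?d"
        using cubical_chain_Cons[OF Suc.prems(1), of "(a, a + 1)"] Suc by simp
      have "2 * Suc k' \<le> card {r. ?d r \<noteq> 0}"
      proof (rule Suc.IH[OF d])
        show "bd ?d t = 0" for t by (rule slice_is_cycle[OF Suc.prems(2)])
        show "?d \<noteq> (\<lambda>_. 0)" using slice by (rule contrapos_nn) (rule fun_cong)
        \<comment> \<open>The slice of a 1-cycle is minus the boundary of the 1-chain
          \<open>u\<close>, so its coefficients sum to zero.\<close>
        assume "k' = 0"
        then have u1: "cubical_chain n 1 u" using u(1) Suc by simp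
        have "(\<Sum>r\<in>{r. ?d r \<noteq> 0}. bd u r) = 0"
          by (rule sum_bd_one_chain[OF u1]) (simp_all add: u(2) cubical_chain_finite[OF d])
        then show "(\<Sum>r\<in>{r. ?d r \<noteq> 0}. ?d r) = 0" by (simp add: u(2) sum_negf)
      qed
      moreover have "0 < card {r. u r \<noteq> 0}" by (rule cubical_chain_card_pos[OF u(1,3)])
      ultimately show ?thesis using u(4) Suc by simp
    next
      case (flat a r0)
      let ?d = "\<lambda>r. c ((a, a) # r)"
      have d: "cubical_chain n k ?d"
        using cubical_chain_Cons[OF Suc.prems(1), of "(a, a)"] by simp
      have "2 * Suc k \<le> card {r. ?d r \<noteq> 0}"
      proof (rule Suc.IH[OF d])
        show "bd ?d t = 0" for t by (rule flat_part_is_cycle[OF Suc.prems(2) flat(1)])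
        show "?d \<noteq> (\<lambda>_. 0)" using flat(2) by (rule contrapos_nn) (rule fun_cong)
      qed (use Suc in simp)
      then show ?thesis using card_flat_part_le[OF Suc.prems(1), of "(a, a)"] by simp
    qed
  qed
qed

text \<open>Every lattice point of a cube is a vertex: its coordinate in the first nondegenerate
  direction is an end of that factor and thereby selects a facet.\<close>

lemma point_in_facet:
  assumes "elem_cube n s" "0 < cdim s" "x \<in> cpts s"
  shows "\<exists>r. bcoef s r \<noteq> 0 \<and> x \<in> cpts r"
  using assms
proof (induction s arbitrary: n x)
  case (Cons y s)
  obtain x0 xs where x: "x = x0 # xs" using Cons.prems(3) by (cases x) (auto simp: cpts_def)
  obtain m where m: "elem_cube m s" and y: "snd y = fst y \<or> snd y = fst y + 1"
    using Cons.prems(1) by (auto simp: elem_cube_Cons)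
  show ?case
  proof (cases "snd y = fst y")
    case True
    then obtain r where "bcoef s r \<noteq> 0" "xs \<in> cpts r"
      using Cons.IH[OF m] Cons.prems x by auto
    with True x Cons.prems(3) show ?thesis
      by (intro exI[of _ "y # r"]) (auto simp: bcoef_Cons_Cons)
  next
    case False
    with x y Cons.prems(3) show ?thesis
      by (intro exI[of _ "(x0, x0) # s"]) (cases y; auto simp: bcoef_Cons_Cons)
  qed
qed simp

text \<open>The equality case of the cell count. The slice and the part below the cut leave room for
  only one cell \<open>t\<close> above it. The slice is then a nonzero multiple of the boundary of
  \<open>t\<close>, and the slab cells over the facets of \<open>t\<close> contain all vertices of
  \<open>(a, a + 1) # t\<close>. Covering the points suffices, because images of cubes are compared
  as point sets.\<close>

lemma small_cycle_contains_cube: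
  assumes "cubical_chain n (Suc k) c" "\<And>t. bd c t = 0" "c \<noteq> (\<lambda>_. 0)"
    and "card {s. c s \<noteq> 0} \<le> 2 * Suc (Suc k)"
  shows "\<exists>T. elem_cube n T \<and> cdim T = Suc (Suc k) \<and> (\<forall>x\<in>cpts T. \<exists>s. c s \<noteq> 0 \<and> x \<in> cpts s)"
  using assms
proof (induction n arbitrary: c)
  case 0
  then obtain s where "c s \<noteq> 0" by auto
  then show ?case using cubical_chain_elem[OF "0.prems"(1), of s] by (simp add: elem_cube_0)
next
  case (Suc n)
  from Suc.prems(1,3) show ?case
  proof (cases rule: nonzero_chain_cases)
    case (slice a r0)
    let ?d = "\<lambda>r. c ((a, a + 1) # r)"
    obtain u where u: "cubical_chain n (Suc k) u" "\<And>r. bd u r = - ?d r" "{r. u r \<noteq> 0} \<noteq> {}"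
      "card {r. ?d r \<noteq> 0} + card {r. u r \<noteq> 0} + 1 \<le> card {s. c s \<noteq> 0}"
      by (rule cycle_slice[OF Suc.prems(1,2) slice]) (rule that)
    have d: "cubical_chain n k ?d"
      using cubical_chain_Cons[OF Suc.prems(1), of "(a, a + 1)"] by simp
    have "2 * Suc k \<le> card {r. ?d r \<noteq> 0}"
    proof (rule card_support_cycle_ge[OF d])
      show "bd ?d t = 0" for t by (rule slice_is_cycle[OF Suc.prems(2)])
      show "?d \<noteq> (\<lambda>_. 0)" using slice by (rule contrapos_nn) (rule fun_cong)
      assume "k = 0"
      then have u1: "cubical_chain n 1 u" using u(1) by simp
      have "(\<Sum>r\<in>{r. ?d r \<noteq> 0}. bd u r) = 0"
        by (rule sum_bd_one_chain[OF u1]) (simp_all add: u(2) cubical_chain_finite[OF d])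
      then show "(\<Sum>r\<in>{r. ?d r \<noteq> 0}. ?d r) = 0" by (simp add: u(2) sum_negf)
    qed
    moreover have "0 < card {r. u r \<noteq> 0}" by (rule cubical_chain_card_pos[OF u(1,3)])
    ultimately have "card {r. u r \<noteq> 0} = 1" using u(4) Suc.prems(4) by simp
    then obtain t where t: "{r. u r \<noteq> 0} = {t}" by (auto simp: card_1_singleton_iff)
    then have elem: "elem_cube n t" "cdim t = Suc k" "u t \<noteq> 0"
      using cubical_chain_elem[OF u(1), of t] by auto
    have d_eq: "?d r = - (u t * bcoef t r)" for r
    proof -
      have "bd u r = (\<Sum>s\<in>{t}. u s * bcoef s r)"
        by (rule bd_eq_sum_bcoef[where n = n]) (use t elem(1) in auto)
      then show ?thesis by (simp add: u(2) minus_equation_iff[of "c _"])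
    qed
    show ?thesis
    proof (rule exI[of _ "(a, a + 1) # t"], intro conjI ballI)
      fix x assume "x \<in> cpts ((a, a + 1) # t)"
      then obtain x0 xs where x: "x = x0 # xs" "a \<le> x0" "x0 \<le> a + 1" "xs \<in> cpts t"
        by (cases x) (simp add: cpts_def, auto)
      obtain r where "bcoef t r \<noteq> 0" "xs \<in> cpts r"
        using point_in_facet[OF elem(1) _ x(4)] elem(2) by auto
      then show "\<exists>s. c s \<noteq> 0 \<and> x \<in> cpts s"
        using d_eq[of r] elem(3) x by (intro exI[of _ "(a, a + 1) # r"]) auto
    qed (use elem in \<open>auto simp: elem_cube_Cons\<close>)
  next
    case (flat a r0)
    let ?d = "\<lambda>r. c ((a, a) # r)"
    have d: "cubical_chain n (Suc k) ?d"
      using cubical_chain_Cons[OF Suc.prems(1), of "(a, a)"] by simp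
    have "\<exists>T. elem_cube n T \<and> cdim T = Suc (Suc k) \<and> (\<forall>x\<in>cpts T. \<exists>s. ?d s \<noteq> 0 \<and> x \<in> cpts s)"
    proof (rule Suc.IH[OF d])
      show "bd ?d t = 0" for t by (rule flat_part_is_cycle[OF Suc.prems(2) flat(1)])
      show "?d \<noteq> (\<lambda>_. 0)" using flat(2) by (rule contrapos_nn) (rule fun_cong)
    qed (use card_flat_part_le[OF Suc.prems(1), of "(a, a)"] Suc.prems(4) in simp)
    then obtain T where T: "elem_cube n T" "cdim T = Suc (Suc k)"
      "\<And>x. x \<in> cpts T \<Longrightarrow> \<exists>s. ?d s \<noteq> 0 \<and> x \<in> cpts s" by blast
    show ?thesis
    proof (rule exI[of _ "(a, a) # T"], intro conjI ballI)
      fix x assume x: "x \<in> cpts ((a, a) # T)"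
      then obtain x0 xs where "x = x0 # xs" by (cases x) (auto simp: cpts_def)
      moreover from this x obtain s where "?d s \<noteq> 0" "xs \<in> cpts s" using T(3)[of xs] by auto
      ultimately show "\<exists>s. c s \<noteq> 0 \<and> x \<in> cpts s"
        using x by (intro exI[of _ "(a, a) # s"]) simp
    qed (use T in \<open>auto simp: elem_cube_Cons\<close>)
  qed
qed

section \<open>Vertices of cubes and automorphisms\<close>

lemma set_nd: "set (nd c) = {i. i < length c \<and> snd (c ! i) \<noteq> fst (c ! i)}"
  by (auto simp: nd_def)

lemma distinct_nd: "distinct (nd c)"
  by (simp add: nd_def)

lemma nd_nth: "i < cdim c \<Longrightarrow> nd c ! i < length c \<and> snd (c ! (nd c ! i)) \<noteq> fst (c ! (nd c ! i))"
  using nth_mem[of i "nd c"] unfolding set_nd cdim_def by blast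

lemma nd_nth_lt: "i < cdim c \<Longrightarrow> nd c ! i < length c"
  using nd_nth by blast

lemma nd_nth_elem:
  "elem_cube n c \<Longrightarrow> i < cdim c \<Longrightarrow> snd (c ! (nd c ! i)) = fst (c ! (nd c ! i)) + 1"
  using nd_nth[of i c] by (auto simp: elem_cube_def)

lemma nd_nth_eq_iff: "i < cdim c \<Longrightarrow> j < cdim c \<Longrightarrow> nd c ! i = nd c ! j \<longleftrightarrow> i = j"
  by (simp add: cdim_def nth_eq_iff_index_eq[OF distinct_nd])

lemma nd_index:
  assumes "j < length c" "snd (c ! j) \<noteq> fst (c ! j)"
  obtains i where "i < cdim c" "nd c ! i = j"
  using assms in_set_conv_nth[of j "nd c"] unfolding set_nd cdim_def by blast

lemma length_vertex [simp]: "length (vertex c S) = length c"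
  by (simp add: vertex_def)

lemma vertex_nth_nd:
  assumes "i < cdim c"
  shows "vertex c S ! (nd c ! i) = fst (c ! (nd c ! i)) + (if i \<in> S then 1 else 0)"
proof -
  have "(\<exists>j\<in>S. j < length (nd c) \<and> nd c ! j = nd c ! i) \<longleftrightarrow> i \<in> S"
    using assms nd_nth_eq_iff[OF _ assms] by (auto simp: cdim_def)
  then show ?thesis using nd_nth_lt[OF assms] by (simp add: vertex_def)
qed

lemma vertex_nth_degenerate:
  assumes "j < length c" "snd (c ! j) = fst (c ! j)"
  shows "vertex c S ! j = fst (c ! j)"
proof -
  have "\<not> (\<exists>i\<in>S. i < length (nd c) \<and> nd c ! i = j)"
    using assms nd_nth[of _ c] by (auto simp: cdim_def)
  then show ?thesis using assms(1) by (simp add: vertex_def)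
qed

lemma cube_point_eqI:
  assumes "elem_cube n c" "x \<in> cpts c" "y \<in> cpts c"
    and "\<And>i. i < cdim c \<Longrightarrow> x ! (nd c ! i) = y ! (nd c ! i)"
  shows "x = y"
proof (rule nth_equalityI)
  show "length x = length y" using assms by (simp add: cpts_def)
  fix j assume "j < length x"
  then have j: "j < length c" using assms by (simp add: cpts_def)
  show "x ! j = y ! j"
  proof (cases "snd (c ! j) = fst (c ! j)")
    case True
    with j assms(2,3) show ?thesis by (force simp: cpts_def)
  next
    case False
    with j assms(4) show ?thesis by (metis nd_index)
  qed
qed

lemma vertex_in_cpts:
  assumes "elem_cube n c"
  shows "vertex c S \<in> cpts c"
  unfolding cpts_def
proof (intro CollectI conjI allI impI)
  fix j assume j: "j < length c"
  have "fst (c ! j) \<le> vertex c S ! j \<and> vertex c S ! j \<le> snd (c ! j)"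
  proof (cases "snd (c ! j) = fst (c ! j)")
    case True
    with j show ?thesis by (simp add: vertex_nth_degenerate)
  next
    case False
    then obtain i where i: "i < cdim c" "nd c ! i = j" using nd_index j by blast
    then show ?thesis using vertex_nth_nd[OF i(1), of S] nd_nth_elem[OF assms i(1)] by auto
  qed
  then show "fst (c ! j) \<le> vertex c S ! j" "vertex c S ! j \<le> snd (c ! j)" by auto
qed simp

lemma cpts_nth_nd:
  assumes "elem_cube n c" "x \<in> cpts c" "i < cdim c"
  shows "x ! (nd c ! i) = fst (c ! (nd c ! i)) \<or> x ! (nd c ! i) = fst (c ! (nd c ! i)) + 1"
proof -
  have "fst (c ! (nd c ! i)) \<le> x ! (nd c ! i)" "x ! (nd c ! i) \<le> snd (c ! (nd c ! i))"
    using assms nd_nth_lt[OF assms(3)] by (auto simp: cpts_def)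
  then show ?thesis using nd_nth_elem[OF assms(1,3)] by linarith
qed

lemma bij_betw_vertex:
  assumes "elem_cube n c"
  shows "bij_betw (vertex c) (Pow {..<cdim c}) (cpts c)"
proof (rule bij_betw_imageI)
  show "inj_on (vertex c) (Pow {..<cdim c})"
  proof (rule inj_onI)
    fix S T assume S: "S \<in> Pow {..<cdim c}" and T: "T \<in> Pow {..<cdim c}"
      and eq: "vertex c S = vertex c T"
    have "i \<in> S \<longleftrightarrow> i \<in> T" if "i < cdim c" for i
      using vertex_nth_nd[OF that, of S] vertex_nth_nd[OF that, of T] eq by (auto split: if_splits)
    then show "S = T" using S T by blast
  qed
  show "vertex c ` Pow {..<cdim c} = cpts c"
  proof (intro equalityI subsetI)
    fix x assume x: "x \<in> cpts c"
    let ?S = "{i. i < cdim c \<and> x ! (nd c ! i) \<noteq> fst (c ! (nd c ! i))}"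
    have "x = vertex c ?S"
    proof (rule cube_point_eqI[OF assms x vertex_in_cpts[OF assms]])
      fix i assume "i < cdim c"
      then show "x ! (nd c ! i) = vertex c ?S ! (nd c ! i)"
        using cpts_nth_nd[OF assms x] by (auto simp: vertex_nth_nd)
    qed
    then show "x \<in> vertex c ` Pow {..<cdim c}" by blast
  qed (use vertex_in_cpts[OF assms] in auto)
qed

lemma vertex_eq_iff:
  assumes "elem_cube n c" "S \<subseteq> {..<cdim c}" "T \<subseteq> {..<cdim c}"
  shows "vertex c S = vertex c T \<longleftrightarrow> S = T"
  using bij_betw_vertex[OF assms(1)] assms(2,3) by (auto simp: bij_betw_def inj_on_def)

lemma card_cpts:
  assumes "elem_cube n c"
  shows "card (cpts c) = 2 ^ cdim c"
  using bij_betw_same_card[OF bij_betw_vertex[OF assms]] by (simp add: card_Pow)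

lemma finite_cpts:
  assumes "elem_cube n c"
  shows "finite (cpts c)"
  using bij_betw_finite[OF bij_betw_vertex[OF assms]] by simp

lemma map_fst_in_cpts: "elem_cube n c \<Longrightarrow> map fst c \<in> cpts c"
  unfolding elem_cube_def cpts_def by force

lemma map_snd_in_cpts: "elem_cube n c \<Longrightarrow> map snd c \<in> cpts c"
  unfolding elem_cube_def cpts_def by force

text \<open>The lowest and the highest corner of each cube lie in the other one, so all bounds
  agree. It makes the target cube of an image unique.\<close>

lemma cpts_inject:
  assumes "elem_cube n c" "elem_cube n d" "cpts c = cpts d"
  shows "c = d"
proof (rule nth_equalityI)
  show len: "length c = length d" using assms by (simp add: elem_cube_def)
  fix i assume i: "i < length c"
  have "map fst c \<in> cpts d" "map snd c \<in> cpts d" "map fst d \<in> cpts c" "map snd d \<in> cpts c"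
    using map_fst_in_cpts map_snd_in_cpts assms by metis+
  then have "fst (c ! i) = fst (d ! i)" "snd (c ! i) = snd (d ! i)"
    using i len by (force simp: cpts_def)+
  then show "c ! i = d ! i" by (simp add: prod_eq_iff)
qed

lemma c1_adj_vertex_insert:
  assumes "elem_cube n c" "i < cdim c" "i \<notin> S"
  shows "c1_adj (vertex c S) (vertex c (insert i S))"
  unfolding c1_adj_def
proof (intro conjI exI[of _ "nd c ! i"] allI impI)
  show "nd c ! i < length (vertex c S)" using nd_nth_lt[OF assms(2)] by simp
  show "\<bar>vertex c S ! (nd c ! i) - vertex c (insert i S) ! (nd c ! i)\<bar> = 1"
    using assms by (simp add: vertex_nth_nd)
  fix j assume "j < length (vertex c S)" and ne: "j \<noteq> nd c ! i"
  then have j: "j < length c" by simp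
  show "vertex c S ! j = vertex c (insert i S) ! j"
  proof (cases "snd (c ! j) = fst (c ! j)")
    case True
    with j show ?thesis by (simp add: vertex_nth_degenerate)
  next
    case False
    then obtain k where "k < cdim c" "nd c ! k = j" using nd_index j by blast
    with ne show ?thesis by (auto simp: vertex_nth_nd)
  qed
qed simp

text \<open>The inequality of truth values is an exclusive or: \<open>T\<close> arises from
  \<open>S\<close> by flipping membership of the one index \<open>j\<close>.\<close>

lemma c1_adj_vertexD:
  assumes "elem_cube n c" "c1_adj (vertex c S) (vertex c T)" "S \<subseteq> {..<cdim c}" "T \<subseteq> {..<cdim c}"
  shows "\<exists>j<cdim c. \<forall>x. x \<in> T \<longleftrightarrow> (x \<in> S) \<noteq> (x = j)"
proof -
  obtain k where k: "k < length c" "\<bar>vertex c S ! k - vertex c T ! k\<bar> = 1"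
    and eq: "\<And>j. j < length c \<Longrightarrow> j \<noteq> k \<Longrightarrow> vertex c S ! j = vertex c T ! j"
    using assms(2) by (auto simp: c1_adj_def)
  have "snd (c ! k) \<noteq> fst (c ! k)"
    using k vertex_nth_degenerate[of k c S] vertex_nth_degenerate[of k c T] by auto
  then obtain j where j: "j < cdim c" "nd c ! j = k" using nd_index k(1) by blast
  have "x \<in> T \<longleftrightarrow> (x \<in> S) \<noteq> (x = j)" if x: "x < cdim c" for x
  proof (cases "x = j")
    case True
    then show ?thesis using k(2) j vertex_nth_nd[OF j(1)] by (auto split: if_splits)
  next
    case False
    then have "vertex c S ! (nd c ! x) = vertex c T ! (nd c ! x)"
      using eq nd_nth_lt[OF x] nd_nth_eq_iff[OF x j(1)] j(2) by blast
    then show ?thesis using False by (auto simp: vertex_nth_nd[OF x] split: if_splits)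
  qed
  then show ?thesis using j(1) assms(3,4) by (metis lessThan_iff subsetD)
qed

text \<open>The automorphisms of the hypercube graph, with vertices written as subsets. The images
  of the zero vertex and of its neighbours determine all others, since any larger set has two
  neighbours with fewer elements.\<close>

lemma cube_automorphism_is_signed_permutation:
  fixes \<phi> :: "nat set \<Rightarrow> nat set"
  assumes bij: "bij_betw \<phi> (Pow {..<q}) (Pow {..<q})"
    and step: "\<And>S i. S \<subseteq> {..<q} \<Longrightarrow> i < q \<Longrightarrow> i \<notin> S \<Longrightarrow>
      \<exists>j<q. \<forall>x. x \<in> \<phi> (insert i S) \<longleftrightarrow> (x \<in> \<phi> S) \<noteq> (x = j)"
  obtains p E where "p permutes {..<q}" "E \<subseteq> {..<q}"
    "\<And>S. S \<subseteq> {..<q} \<Longrightarrow> \<phi> S = {i. i < q \<and> ((i \<in> E) \<noteq> (p i \<in> S))}"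
proof -
  \<comment> \<open>\<open>E\<close> is the image of the zero vertex; \<open>\<rho> i\<close> below
    is the coordinate that flips when \<open>i\<close> is switched on there.\<close>
  define E where "E = \<phi> {}"
  have in_Q: "\<phi> S \<subseteq> {..<q}" if "S \<subseteq> {..<q}" for S
    using bij that by (auto simp: bij_betw_def)
  have inj: "S = T" if "\<phi> S = \<phi> T" "S \<subseteq> {..<q}" "T \<subseteq> {..<q}" for S T
    using bij that by (auto simp: bij_betw_def inj_on_def)
  have "\<forall>i\<in>{..<q}. \<exists>j<q. \<forall>x. x \<in> \<phi> {i} \<longleftrightarrow> (x \<in> E) \<noteq> (x = j)"
    using step[of "{}"] by (simp add: E_def)
  then obtain \<rho> where \<rho>: "\<And>i. i < q \<Longrightarrow> \<rho> i < q"
    "\<And>i x. i < q \<Longrightarrow> x \<in> \<phi> {i} \<longleftrightarrow> (x \<in> E) \<noteq> (x = \<rho> i)"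
    by (metis lessThan_iff)
  have inj_\<rho>: "i = j" if "\<rho> i = \<rho> j" "i < q" "j < q" for i j
  proof -
    have "\<phi> {i} = \<phi> {j}" using \<rho>(2) that by auto
    then show ?thesis using inj[of "{i}" "{j}"] that by simp
  qed
  have formula: "x \<in> \<phi> S \<longleftrightarrow> (x \<in> E) \<noteq> (x \<in> \<rho> ` S)" if "S \<subseteq> {..<q}" for S x
    using that
  proof (induction "card S" arbitrary: S x rule: less_induct)
    case (less S)
    have fin: "finite S" using less.prems finite_subset by blast
    show ?case
    proof (cases "\<exists>i j. i \<in> S \<and> j \<in> S \<and> i \<noteq> j")
      case False
      then have "S = {} \<or> (\<exists>i. S = {i})" by blast
      then show ?thesis using \<rho>(2) less.prems by (auto simp: E_def)
    next
      case True
      then obtain i j where ij: "i \<in> S" "j \<in> S" "i \<noteq> j" by blast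
      then have lt: "i < q" "j < q" using less.prems by auto
      have IH: "y \<in> \<phi> (S - {k}) \<longleftrightarrow> (y \<in> E) \<noteq> (y \<in> \<rho> ` (S - {k}))" if "k \<in> S" for k y
        by (rule less.hyps) (use less.prems card_Diff1_less[OF fin that] in auto)
      have "card (S - {i} - {j}) < card S"
        using ij fin by (intro psubset_card_mono) auto
      then have IH2: "y \<in> \<phi> (S - {i} - {j}) \<longleftrightarrow> (y \<in> E) \<noteq> (y \<in> \<rho> ` (S - {i} - {j}))" for y
        by (rule less.hyps) (use less.prems in auto)
      have im: "\<rho> ` (S - {k}) = \<rho> ` S - {\<rho> k}" if "k \<in> S" for k
        using inj_\<rho> less.prems that by blast
      have im2: "\<rho> ` (S - {i} - {j}) = \<rho> ` S - {\<rho> i} - {\<rho> j}"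
        using inj_\<rho> less.prems ij by blast
      have nb: "\<exists>a. \<forall>y. y \<in> \<phi> S \<longleftrightarrow> (y \<in> \<phi> (S - {k})) \<noteq> (y = a)" if "k \<in> S" for k
        using step[of "S - {k}" k] less.prems that by (auto simp: insert_absorb)
      obtain a where a: "\<And>y. y \<in> \<phi> S \<longleftrightarrow> (y \<in> \<phi> (S - {i})) \<noteq> (y = a)" using nb[OF ij(1)] by blast
      obtain b where b: "\<And>y. y \<in> \<phi> S \<longleftrightarrow> (y \<in> \<phi> (S - {j})) \<noteq> (y = b)" using nb[OF ij(2)] by blast
      have mem: "\<rho> i \<in> \<rho> ` S" "\<rho> j \<in> \<rho> ` S" using ij by auto
      have ne: "\<rho> i \<noteq> \<rho> j" using inj_\<rho> ij lt by blast
      have A: "y \<in> \<phi> S \<longleftrightarrow> (((y \<in> E) \<noteq> (y \<in> \<rho> ` S)) \<noteq> (y = \<rho> i)) \<noteq> (y = a)" for y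
        using a[of y] IH[OF ij(1), of y] im[OF ij(1)] mem by auto
      have B: "y \<in> \<phi> S \<longleftrightarrow> (((y \<in> E) \<noteq> (y \<in> \<rho> ` S)) \<noteq> (y = \<rho> j)) \<noteq> (y = b)" for y
        using b[of y] IH[OF ij(2), of y] im[OF ij(2)] mem by auto
      \<comment> \<open>\<open>\<phi> S\<close> is a common neighbour of the known vertices
        \<open>\<phi> (S - {i})\<close> and \<open>\<phi> (S - {j})\<close>, and there are only two
        of these.\<close>
      have "a = \<rho> i \<or> a = \<rho> j"
        using A[of "\<rho> i"] B[of "\<rho> i"] A[of "\<rho> j"] B[of "\<rho> j"] A[of a] B[of a] ne by argo
      then show ?thesis
      proof
        assume "a = \<rho> i"
        then show ?thesis using A by auto
      next
        assume "a = \<rho> j"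
        \<comment> \<open>The unwanted common neighbour is already the image of
          \<open>S - {i} - {j}\<close>, so injectivity excludes it.\<close>
        have "y \<in> \<phi> S \<longleftrightarrow> y \<in> \<phi> (S - {i} - {j})" for y
          unfolding A IH2 im2 \<open>a = \<rho> j\<close> using mem ne by (cases "y = \<rho> i"; cases "y = \<rho> j") simp_all
        then have "\<phi> S = \<phi> (S - {i} - {j})" by blast
        then have "S = S - {i} - {j}" by (rule inj) (use less.prems in auto)
        then show ?thesis using ij by blast
      qed
    qed
  qed
  have "\<rho> ` {..<q} = {..<q}"
    by (rule endo_inj_surj) (use \<rho>(1) inj_\<rho> in \<open>auto simp: inj_on_def\<close>)
  then have "bij_betw \<rho> {..<q} {..<q}"
    using inj_\<rho> by (auto simp: bij_betw_def inj_on_def)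
  \<comment> \<open>\<open>p\<close> inverts \<open>\<rho>\<close>: target coordinate
    \<open>i\<close> is governed by source coordinate \<open>p i\<close>. Outside
    \<open>{..<q}\<close> it is the identity, as \<open>permutes\<close> demands.\<close>
  define p where "p i = (if i < q then inv_into {..<q} \<rho> i else i)" for i
  have "bij_betw p {..<q} {..<q}"
    using bij_betw_inv_into[OF \<open>bij_betw \<rho> {..<q} {..<q}\<close>]
    by (rule bij_betw_cong[THEN iffD1, rotated]) (simp add: p_def)
  then have perm: "p permutes {..<q}"
    by (rule bij_imp_permutes) (simp add: p_def)
  have p_mem: "p i \<in> S \<longleftrightarrow> i \<in> \<rho> ` S" if "i < q" "S \<subseteq> {..<q}" for i S
  proof -
    have r: "\<rho> (p i) = i" "p i < q"
      using that(1) \<open>\<rho> ` {..<q} = {..<q}\<close> f_inv_into_f[of i \<rho> "{..<q}"] inv_into_into[of i \<rho> "{..<q}"]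
      by (auto simp: p_def)
    then show ?thesis using inj_\<rho> that(2) by (metis imageE image_eqI lessThan_iff subsetD)
  qed
  show ?thesis
  proof (rule that[OF perm, of E])
    show "E \<subseteq> {..<q}" using in_Q by (simp add: E_def)
    fix S assume S: "S \<subseteq> {..<q}"
    show "\<phi> S = {i. i < q \<and> ((i \<in> E) \<noteq> (p i \<in> S))}"
      using in_Q[OF S] formula[OF S] p_mem[OF _ S] by auto
  qed
qed

section \<open>Signs as determinants\<close>

lemma cubesD:
  assumes "s \<in> cubes X n q"
  shows "elem_cube n s" "cdim s = q" "cpts s \<subseteq> X" "length s = n"
  using assms by (auto simp: cubes_def elem_cube_def)

lemma finite_all_cubes:
  assumes "finite X"
  shows "finite (all_cubes X n)"
proof (rule inj_on_finite[of cpts _ "Pow X"])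
  show "inj_on cpts (all_cubes X n)"
    by (auto simp: inj_on_def all_cubes_def intro: cpts_inject)
qed (use assms in \<open>auto simp: all_cubes_def\<close>)

lemma finite_cubes:
  assumes "finite X"
  shows "finite (cubes X n q)"
  by (rule finite_subset[OF _ finite_all_cubes[OF assms, of n]]) (auto simp: cubes_def all_cubes_def)

lemma cubes_unique:
  assumes "s \<in> cubes X n q" "t \<in> cubes X n q'" "cpts s = cpts t"
  shows "s = t"
  using assms cpts_inject by (auto simp: cubes_def)

lemma vertex_insert:
  assumes "j < cdim c" "j \<notin> S"
  shows "vertex c (insert j S) = (vertex c S)[nd c ! j := vertex c S ! (nd c ! j) + 1]"
proof (rule nth_equalityI)
  fix b assume "b < length (vertex c (insert j S))"
  then have b: "b < length c" by simp
  show "vertex c (insert j S) ! b = (vertex c S)[nd c ! j := vertex c S ! (nd c ! j) + 1] ! b"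
  proof (cases "snd (c ! b) = fst (c ! b)")
    case True
    moreover have "nd c ! j \<noteq> b" using nd_nth[OF assms(1)] True by auto
    ultimately show ?thesis using b by (simp add: vertex_nth_degenerate)
  next
    case False
    then obtain k where k: "k < cdim c" "nd c ! k = b" using nd_index b by blast
    have "nd c ! j = b \<longleftrightarrow> k = j" using k nd_nth_eq_iff[OF k(1) assms(1)] by auto
    then show ?thesis
      using vertex_nth_nd[OF k(1), of S] vertex_nth_nd[OF k(1), of "insert j S"] k(2) b assms(2)
      by (auto simp: nth_list_update)
  qed
qed simp

abbreviation signed_perm_on :: "(point \<Rightarrow> point) \<Rightarrow> ecube \<Rightarrow> ecube \<Rightarrow> nat \<Rightarrow> (nat \<Rightarrow> nat) \<Rightarrow> nat set \<Rightarrow> bool" where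
  "signed_perm_on f s t q p E \<equiv>
    \<forall>S\<in>Pow {..<q}. f (vertex s S) = vertex t {i. i < q \<and> ((i \<in> E) \<noteq> (p i \<in> S))}"

text \<open>A cube and its image have equally many points, so \<open>f\<close> is injective on
  \<open>s\<close>. Continuity then sends edges to edges instead of collapsing them, and the
  classification of hypercube automorphisms applies to \<open>f\<close> read in vertex
  coordinates.\<close>

lemma cube_map_signed_perm:
  assumes f: "c1_continuous X f" and s: "s \<in> cubes X n q" and t: "t \<in> cubes X n q"
    and image: "f ` cpts s = cpts t"
  obtains p E where "p permutes {..<q}" "E \<subseteq> {..<q}" "signed_perm_on f s t q p E"
proof -
  note sD = cubesD[OF s] and tD = cubesD[OF t]
  have vs: "bij_betw (vertex s) (Pow {..<q}) (cpts s)" and vt: "bij_betw (vertex t) (Pow {..<q}) (cpts t)"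
    using bij_betw_vertex[OF sD(1)] bij_betw_vertex[OF tD(1)] sD(2) tD(2) by simp_all
  have "card (f ` cpts s) = card (cpts s)"
    using card_cpts[OF sD(1)] card_cpts[OF tD(1)] sD(2) tD(2) image by simp
  then have inj_f: "inj_on f (cpts s)" using eq_card_imp_inj_on finite_cpts[OF sD(1)] by blast
  then have "bij_betw f (cpts s) (cpts t)" using image by (simp add: bij_betw_def)
  define \<phi> where "\<phi> = inv_into (Pow {..<q}) (vertex t) \<circ> (f \<circ> vertex s)"
  have bij: "bij_betw \<phi> (Pow {..<q}) (Pow {..<q})"
    unfolding \<phi>_def
    by (rule bij_betw_trans[OF bij_betw_trans[OF vs \<open>bij_betw f _ _\<close>] bij_betw_inv_into[OF vt]])
  have v\<phi>: "vertex t (\<phi> S) = f (vertex s S)" if "S \<subseteq> {..<q}" for S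
  proof -
    have "f (vertex s S) \<in> vertex t ` Pow {..<q}"
      using vertex_in_cpts[OF sD(1), of S] image vt by (auto simp: bij_betw_def)
    then show ?thesis unfolding \<phi>_def o_def by (rule f_inv_into_f)
  qed
  have \<phi>_sub: "\<phi> S \<subseteq> {..<q}" if "S \<subseteq> {..<q}" for S
    using bij that by (auto simp: bij_betw_def)
  have step: "\<exists>j<q. \<forall>x. x \<in> \<phi> (insert i S) \<longleftrightarrow> (x \<in> \<phi> S) \<noteq> (x = j)"
    if S: "S \<subseteq> {..<q}" and i: "i < q" "i \<notin> S" for S i
  proof -
    have iS: "insert i S \<subseteq> {..<q}" using S i by auto
    have pts: "vertex s S \<in> cpts s" "vertex s (insert i S) \<in> cpts s"
      using vertex_in_cpts[OF sD(1)] by blast+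
    have adj: "c1_adj (vertex s S) (vertex s (insert i S))"
      using c1_adj_vertex_insert[OF sD(1)] i sD(2) by blast
    then have "f (vertex s S) = f (vertex s (insert i S)) \<or> c1_adj (f (vertex s S)) (f (vertex s (insert i S)))"
      using f pts sD(3) by (auto simp: c1_continuous_def)
    moreover have "f (vertex s S) \<noteq> f (vertex s (insert i S))"
    proof
      assume "f (vertex s S) = f (vertex s (insert i S))"
      then have "vertex s S = vertex s (insert i S)" using inj_f pts by (auto dest: inj_onD)
      then show False using adj by (auto simp: c1_adj_def)
    qed
    ultimately have "c1_adj (vertex t (\<phi> S)) (vertex t (\<phi> (insert i S)))"
      using v\<phi>[OF S] v\<phi>[OF iS] by simp
    then show ?thesis
      using c1_adj_vertexD[OF tD(1)] \<phi>_sub[OF S] \<phi>_sub[OF iS] tD(2) by blast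
  qed
  obtain p E where p: "p permutes {..<q}" and E: "E \<subseteq> {..<q}"
    and \<phi>: "\<And>S. S \<subseteq> {..<q} \<Longrightarrow> \<phi> S = {i. i < q \<and> ((i \<in> E) \<noteq> (p i \<in> S))}"
    by (rule cube_automorphism_is_signed_permutation[OF bij step]) (assumption | rule that)+
  have "signed_perm_on f s t q p E"
  proof
    fix S assume "S \<in> Pow {..<q}"
    then have "S \<subseteq> {..<q}" by simp
    then show "f (vertex s S) = vertex t {i. i < q \<and> ((i \<in> E) \<noteq> (p i \<in> S))}"
      using v\<phi>[OF \<open>S \<subseteq> _\<close>] \<phi>[OF \<open>S \<subseteq> _\<close>] by simp
  qed
  with p E show ?thesis using that by blast
qed

text \<open>The vertex \<open>S = {}\<close> determines \<open>E\<close>, and the singletons then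
  determine \<open>p\<close>; so the double sum in \<open>fcoef\<close> has a single nonzero
  term.\<close>

lemma fcoef_signed_perm:
  assumes s: "s \<in> cubes X n q" and t: "t \<in> cubes X n q" and image: "f ` cpts s = cpts t"
    and p: "p permutes {..<q}" and E: "E \<subseteq> {..<q}" and pE: "signed_perm_on f s t q p E"
  shows "fcoef X n f s t = of_int (sign p) * (- 1) ^ card E"
proof -
  note tD = cubesD[OF t]
  have uniq: "signed_perm_on f s t q p' E' \<longleftrightarrow> p' = p \<and> E' = E"
    if p': "p' permutes {..<q}" and E': "E' \<subseteq> {..<q}" for p' E'
  proof
    assume pE': "signed_perm_on f s t q p' E'"
    have eq: "{i. i < q \<and> ((i \<in> E) \<noteq> (p i \<in> S))} = {i. i < q \<and> ((i \<in> E') \<noteq> (p' i \<in> S))}"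
      if "S \<subseteq> {..<q}" for S
    proof -
      have "vertex t {i. i < q \<and> ((i \<in> E) \<noteq> (p i \<in> S))} = vertex t {i. i < q \<and> ((i \<in> E') \<noteq> (p' i \<in> S))}"
        using bspec[OF pE, of S] bspec[OF pE', of S] that by simp
      then show ?thesis by (subst (asm) vertex_eq_iff[OF tD(1)]) (use tD(2) in auto)
    qed
    have "E' = E" using eq[of "{}"] E E' by auto
    moreover have "p' i = p i" for i
    proof (cases "i < q")
      case True
      then have "p i < q" using permutes_in_image[OF p, of i] by simp
      with True show ?thesis using eq[of "{p i}"] \<open>E' = E\<close> by auto
    next
      case False
      then show ?thesis using p p' by (simp add: permutes_def)
    qed
    ultimately show "p' = p \<and> E' = E" by auto
  qed (use pE in auto)
  have "fcoef X n f s t = (\<Sum>p'\<in>{p. p permutes {..<q}}. \<Sum>E'\<in>Pow {..<q}.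
      if p' = p \<and> E' = E then of_int (sign p') * (- 1) ^ card E' else 0)"
    using t image uniq cubesD(2)[OF s] unfolding fcoef_def Let_def
    by (auto intro!: sum.cong)
  also have "\<dots> = (\<Sum>p'\<in>{p. p permutes {..<q}}. if p' = p then of_int (sign p) * (- 1) ^ card E else 0)"
    using E by (intro sum.cong) (auto simp: sum.delta)
  also have "\<dots> = of_int (sign p) * (- 1) ^ card E"
    using p by (simp add: finite_permutations)
  finally show ?thesis .
qed

lemma fcoef_cases:
  assumes f: "c1_continuous X f" and s: "s \<in> cubes X n q"
  shows "fcoef X n f s t \<in> {-1, 0, 1}"
proof (cases "t \<in> cubes X n q \<and> f ` cpts s = cpts t")
  case True
  then obtain p E where "p permutes {..<q}" "E \<subseteq> {..<q}" "signed_perm_on f s t q p E"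
    using cube_map_signed_perm[OF f s] by blast
  then have "fcoef X n f s t = of_int (sign p) * (- 1) ^ card E"
    using fcoef_signed_perm[OF s] True by blast
  then show ?thesis by (cases "even (card E)") (auto simp: sign_def)
next
  case False
  then show ?thesis using cubesD(2)[OF s] by (auto simp: fcoef_def)
qed

lemma fcoef_nonzeroD:
  assumes "s \<in> cubes X n q" "fcoef X n f s t \<noteq> 0"
  shows "t \<in> cubes X n q" "f ` cpts s = cpts t"
  using assms cubesD(2)[OF assms(1)] by (auto simp: fcoef_def Let_def split: if_splits)

text \<open>Faces of \<open>s\<close> inherit the matrix \<open>D\<close>, so the signs of \<open>f\<close> on the facets of \<open>s\<close> are minors of a
  single determinant.\<close>
definition has_jacobian :: "(point \<Rightarrow> point) \<Rightarrow> ecube \<Rightarrow> (nat \<Rightarrow> nat \<Rightarrow> rat) \<Rightarrow> nat set \<Rightarrow> bool" where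
  "has_jacobian f s D A \<longleftrightarrow> (\<forall>x\<in>cpts s. \<forall>b<length s. x[b := x ! b + 1] \<in> cpts s \<longrightarrow>
     (\<forall>a\<in>A. of_int (f (x[b := x ! b + 1]) ! a) - of_int (f x ! a) = D a b))"

lemma has_jacobian_mono:
  "has_jacobian f s D A \<Longrightarrow> cpts r \<subseteq> cpts s \<Longrightarrow> length r = length s \<Longrightarrow> B \<subseteq> A \<Longrightarrow> has_jacobian f r D B"
  unfolding has_jacobian_def by (metis subsetD)

lemma prod_signs: "finite A \<Longrightarrow> E \<subseteq> A \<Longrightarrow> (\<Prod>i\<in>A. if i \<in> E then - 1 else 1 :: rat) = (- 1) ^ card E"
  by (simp add: prod.If_cases Int_absorb1)

text \<open>The value does not depend on \<open>S\<close>: the differences of \<open>f\<close> are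
  the same at all vertices and therefore form one matrix.\<close>

lemma signed_perm_jacobian_entry:
  assumes s: "s \<in> cubes X n q" and t: "t \<in> cubes X n q"
    and p: "p permutes {..<q}" and pE: "signed_perm_on f s t q p E"
    and i: "i < q" and j: "j < q" "S \<subseteq> {..<q}" "j \<notin> S"
  shows "of_int (f (vertex s (insert j S)) ! (nd t ! i)) - of_int (f (vertex s S) ! (nd t ! i))
    = (if p i = j then if i \<in> E then - 1 else 1 else 0 :: rat)"
proof -
  have v: "f (vertex s S') ! (nd t ! i) = fst (t ! (nd t ! i)) + (if (i \<in> E) \<noteq> (p i \<in> S') then 1 else 0)"
    if "S' \<subseteq> {..<q}" for S'
    using pE that i cubesD(2)[OF t] by (simp add: vertex_nth_nd)
  show ?thesis using v[of S] v[of "insert j S"] j by auto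
qed

lemma has_jacobian_signed_perm:
  assumes s: "s \<in> cubes X n q" and t: "t \<in> cubes X n q"
    and p: "p permutes {..<q}" and pE: "signed_perm_on f s t q p E"
  obtains D where "has_jacobian f s D (set (nd t))"
    "\<And>i j. i < q \<Longrightarrow> j < q \<Longrightarrow> D (nd t ! i) (nd s ! j) = (if p i = j then if i \<in> E then - 1 else 1 else 0)"
proof -
  note sD = cubesD[OF s] and tD = cubesD[OF t]
  define v0 where "v0 = vertex s {}"
  \<comment> \<open>Differences at the lowest corner. They are indexed by coordinates of the ambient
    lattice, not by positions in \<open>nd\<close>, so that faces can share the matrix.\<close>
  define D :: "nat \<Rightarrow> nat \<Rightarrow> rat" where
    "D a b = of_int (f (v0[b := v0 ! b + 1]) ! a) - of_int (f v0 ! a)" for a b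
  have D_entry: "D (nd t ! i) (nd s ! j) = (if p i = j then if i \<in> E then - 1 else 1 else 0)"
    if "i < q" "j < q" for i j
    using signed_perm_jacobian_entry[OF s t p pE, of i j "{}"] that
    unfolding D_def v0_def by (simp add: vertex_insert sD(2))
  have "has_jacobian f s D (set (nd t))"
    unfolding has_jacobian_def
  proof (intro ballI allI impI)
    fix x b a
    assume x: "x \<in> cpts s" and b: "b < length s" and y: "x[b := x ! b + 1] \<in> cpts s" and a: "a \<in> set (nd t)"
    obtain S where S: "S \<subseteq> {..<q}" "x = vertex s S"
      using x bij_betw_vertex[OF sD(1)] sD(2) by (auto simp: bij_betw_def)
    obtain i where i: "i < q" "a = nd t ! i"
      using a tD(2) by (auto simp: in_set_conv_nth cdim_def)
    have len: "length x = length s" using x by (simp add: cpts_def)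
    have bounds: "fst (s ! b) \<le> x ! b" "x ! b + 1 \<le> snd (s ! b)"
      using x y b len by (auto simp: cpts_def dest!: spec[of _ b])
    then have "snd (s ! b) \<noteq> fst (s ! b)" by linarith
    then obtain j where j: "j < cdim s" "nd s ! j = b" by (rule nd_index[OF b])
    have "j \<notin> S"
      using vertex_nth_nd[OF j(1), of S] bounds nd_nth_elem[OF sD(1) j(1)] S(2) j(2) by auto
    then have "x[b := x ! b + 1] = vertex s (insert j S)"
      using vertex_insert[OF j(1)] j(2) S(2) by simp
    then show "of_int (f (x[b := x ! b + 1]) ! a) - of_int (f x ! a) = D a b"
      using signed_perm_jacobian_entry[OF s t p pE i(1) _ S(1) \<open>j \<notin> S\<close>] j sD(2) S(2) i D_entry[OF i(1), of j] by simp
  qed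
  then show ?thesis using that D_entry by blast
qed

text \<open>In the Leibniz formula only the permutation of the signed permutation survives, and its
  product of entries is \<open>(- 1) ^ card E\<close>. \<open>D\<close> may come from a larger cube
  that has \<open>s\<close> as a face.\<close>

lemma fcoef_eq_det:
  assumes f: "c1_continuous X f" and s: "s \<in> cubes X n q" and t: "t \<in> cubes X n q"
    and image: "f ` cpts s = cpts t" and D: "has_jacobian f s D (set (nd t))"
  shows "fcoef X n f s t = det (mat q q (\<lambda>(i, j). D (nd t ! i) (nd s ! j)))"
proof -
  note sD = cubesD[OF s] and tD = cubesD[OF t]
  obtain p E where p: "p permutes {..<q}" and E: "E \<subseteq> {..<q}" and pE: "signed_perm_on f s t q p E"
    by (rule cube_map_signed_perm[OF f s t image])
  let ?\<epsilon> = "\<lambda>i. if i \<in> E then - 1 else 1 :: rat"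
  have entry: "D (nd t ! i) (nd s ! j) = (if p i = j then ?\<epsilon> i else 0)" if ij: "i < q" "j < q" for i j
  proof -
    let ?x = "vertex s {}"
    have y: "?x[nd s ! j := ?x ! (nd s ! j) + 1] = vertex s {j}"
      using vertex_insert[of j s "{}"] ij sD(2) by simp
    have "nd t ! i \<in> set (nd t)" "nd s ! j < length s"
      using ij tD(2) sD(2) nd_nth_lt[of j s] by (auto simp: cdim_def)
    then have "of_int (f (vertex s {j}) ! (nd t ! i)) - of_int (f ?x ! (nd t ! i)) = D (nd t ! i) (nd s ! j)"
      using D vertex_in_cpts[OF sD(1)] y unfolding has_jacobian_def by metis
    then show ?thesis using signed_perm_jacobian_entry[OF s t p pE ij, of "{}"] by simp
  qed
  let ?M = "mat q q (\<lambda>(i, j). D (nd t ! i) (nd s ! j))"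
  have lt: "p' i < q" if "p' permutes {..<q}" "i < q" for p' i
    using permutes_in_image[OF that(1), of i] that(2) by simp
  have "det ?M = (\<Sum>p'\<in>{p'. p' permutes {..<q}}. of_int (sign p') * (\<Prod>i<q. ?M $$ (i, p' i)))"
    by (subst det_def'[of _ q]) (simp_all add: atLeast0LessThan)
  also have "\<dots> = (\<Sum>p'\<in>{p'. p' permutes {..<q}}. if p' = p then of_int (sign p) * (- 1) ^ card E else 0)"
  proof (rule sum.cong[OF refl])
    fix p' assume "p' \<in> {p'. p' permutes {..<q}}"
    then have p': "p' permutes {..<q}" by simp
    have "(\<Prod>i<q. ?M $$ (i, p' i)) = (\<Prod>i<q. if p i = p' i then ?\<epsilon> i else 0)"
      by (rule prod.cong) (simp_all add: lt[OF p'] entry)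
    also have "\<dots> = (if p' = p then (- 1) ^ card E else 0)"
    proof (cases "p' = p")
      case True
      then show ?thesis using prod_signs[of "{..<q}" E] E by simp
    next
      case False
      then obtain i where "p' i \<noteq> p i" by blast
      moreover from this have "i < q" using p p' by (metis lessThan_iff permutes_def)
      ultimately show ?thesis using False by (auto intro!: prod_zero bexI[of _ i])
    qed
    finally show "of_int (sign p') * (\<Prod>i<q. ?M $$ (i, p' i))
      = (if p' = p then of_int (sign p) * (- 1) ^ card E else 0)" by simp
  qed
  also have "\<dots> = of_int (sign p) * (- 1) ^ card E"
    using p by (simp add: finite_permutations)
  finally show ?thesis using fcoef_signed_perm[OF s t image p E pE] by simp
qed

section \<open>The chain map property\<close>

definition face :: "ecube \<Rightarrow> nat \<Rightarrow> int \<Rightarrow> ecube" where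
  "face c j v = c[nd c ! j := (v, v)]"

abbreviation lower :: "ecube \<Rightarrow> nat \<Rightarrow> ecube" where
  "lower c j \<equiv> face c j (fst (c ! (nd c ! j)))"

abbreviation upper :: "ecube \<Rightarrow> nat \<Rightarrow> ecube" where
  "upper c j \<equiv> face c j (snd (c ! (nd c ! j)))"

lemma length_face [simp]: "length (face c j v) = length c"
  by (simp add: face_def)

lemma elem_cube_face:
  assumes "elem_cube n c"
  shows "elem_cube n (face c j v)"
proof -
  have "snd (face c j v ! i) = fst (face c j v ! i) \<or> snd (face c j v ! i) = fst (face c j v ! i) + 1"
    if "i < n" for i
    using assms that by (cases "i = nd c ! j") (auto simp: elem_cube_def face_def)
  then show ?thesis using assms by (simp add: elem_cube_def)
qed

lemma nd_update_degenerate: "nd (c[k := (v, v)]) = filter (\<lambda>i. i \<noteq> k) (nd c)"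
proof -
  have "snd (c[k := (v, v)] ! i) \<noteq> fst (c[k := (v, v)] ! i) \<longleftrightarrow> snd (c ! i) \<noteq> fst (c ! i) \<and> i \<noteq> k"
    if "i < length c" for i
    using that by (cases "i = k") auto
  then show ?thesis by (auto simp: nd_def intro!: filter_cong)
qed

lemma filter_neq_nth:
  assumes "distinct xs" "j < length xs"
  shows "filter (\<lambda>i. i \<noteq> xs ! j) xs = take j xs @ drop (Suc j) xs"
proof -
  have xs: "xs = take j xs @ xs ! j # drop (Suc j) xs" using assms(2) by (rule id_take_nth_drop)
  then have d: "distinct (take j xs @ xs ! j # drop (Suc j) xs)" using assms(1) by simp
  have "filter (\<lambda>i. i \<noteq> xs ! j) (take j xs @ xs ! j # drop (Suc j) xs) = take j xs @ drop (Suc j) xs"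
    using d by (auto intro!: arg_cong2[of _ _ _ _ append] simp: filter_id_conv)
  then show ?thesis using xs by simp
qed

lemma nd_face: "j < cdim c \<Longrightarrow> nd (face c j v) = take j (nd c) @ drop (Suc j) (nd c)"
  unfolding face_def nd_update_degenerate by (rule filter_neq_nth) (simp_all add: distinct_nd cdim_def)

lemma cdim_face: "j < cdim c \<Longrightarrow> cdim (face c j v) = cdim c - 1"
  by (auto simp: cdim_def nd_face)

text \<open>Skipping position \<open>j\<close> is the index shift of \<open>mat_delete\<close>; this
  is why passing to facets produces minors.\<close>

lemma nd_face_nth:
  "j < cdim c \<Longrightarrow> k < cdim c - 1 \<Longrightarrow> nd (face c j v) ! k = nd c ! (if k < j then k else Suc k)"
  by (auto simp: nd_face nth_append cdim_def min_def)

lemma set_nd_face_subset: "set (nd (face c j v)) \<subseteq> set (nd c)"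
  unfolding face_def nd_update_degenerate by auto

lemma cpts_face:
  assumes "j < cdim c" "fst (c ! (nd c ! j)) \<le> v" "v \<le> snd (c ! (nd c ! j))"
  shows "cpts (face c j v) = {x \<in> cpts c. x ! (nd c ! j) = v}"
proof (intro equalityI subsetI)
  fix x assume x: "x \<in> cpts (face c j v)"
  then have b: "fst (face c j v ! i) \<le> x ! i \<and> x ! i \<le> snd (face c j v ! i)" if "i < length c" for i
    using that by (simp add: cpts_def)
  have v: "x ! (nd c ! j) = v"
    using b[of "nd c ! j"] nd_nth_lt[OF assms(1)] by (simp add: face_def)
  have "fst (c ! i) \<le> x ! i \<and> x ! i \<le> snd (c ! i)" if "i < length c" for i
    using b[OF that] v assms by (cases "i = nd c ! j") (auto simp: face_def nth_list_update)
  then show "x \<in> {x \<in> cpts c. x ! (nd c ! j) = v}" using x v by (simp add: cpts_def)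
next
  fix x assume x: "x \<in> {x \<in> cpts c. x ! (nd c ! j) = v}"
  have "fst (face c j v ! i) \<le> x ! i \<and> x ! i \<le> snd (face c j v ! i)" if "i < length c" for i
    using x that by (cases "i = nd c ! j") (auto simp: cpts_def face_def)
  then show "x \<in> cpts (face c j v)" using x by (simp add: cpts_def)
qed

lemma cpts_lower:
  "elem_cube n c \<Longrightarrow> j < cdim c \<Longrightarrow> cpts (lower c j) = {x \<in> cpts c. x ! (nd c ! j) = fst (c ! (nd c ! j))}"
  by (subst cpts_face) (simp_all add: nd_nth_elem)

lemma cpts_upper:
  "elem_cube n c \<Longrightarrow> j < cdim c \<Longrightarrow> cpts (upper c j) = {x \<in> cpts c. x ! (nd c ! j) = snd (c ! (nd c ! j))}"
  by (subst cpts_face) (simp_all add: nd_nth_elem)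

text \<open>Phrased as the complement of the condition for the lower facet, so that one equivalence
  determines the images of both facets.\<close>

lemma cpts_upper':
  "elem_cube n c \<Longrightarrow> j < cdim c \<Longrightarrow> cpts (upper c j) = {x \<in> cpts c. x ! (nd c ! j) \<noteq> fst (c ! (nd c ! j))}"
  unfolding cpts_upper using cpts_nth_nd[of n c _ j] by (auto simp: nd_nth_elem)

lemma face_in_cubes:
  assumes "s \<in> cubes X n (Suc q)" "j < Suc q"
  shows "lower s j \<in> cubes X n q" "upper s j \<in> cubes X n q"
  using cubesD[OF assms(1)] assms(2) elem_cube_face[of n s] cpts_lower[of n s j] cpts_upper[of n s j]
  by (auto simp: cubes_def cdim_face)

lemma bcoef_faces:
  "bcoef s t = (\<Sum>i<cdim s. (- 1) ^ (i + 1) *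
     ((if lower s i = t then 1 else 0) - (if upper s i = t then 1 else 0)))"
  by (simp add: bcoef_def face_def cdim_def)

lemma bcoef_nonzeroD:
  assumes "bcoef s t \<noteq> 0"
  shows "\<exists>j<cdim s. t = lower s j \<or> t = upper s j"
proof -
  obtain j where "j \<in> {..<cdim s}" "(- 1) ^ (j + 1) *
     ((if lower s j = t then 1 else 0) - (if upper s j = t then 1 else 0)) \<noteq> (0 :: rat)"
    using assms unfolding bcoef_faces by (rule sum.not_neutral_contains_not_neutral)
  then show ?thesis by (auto split: if_splits)
qed

lemma sum_bcoef:
  assumes "finite X" "s \<in> cubes X n (Suc q)"
  shows "(\<Sum>r\<in>cubes X n q. bcoef s r * g r) = (\<Sum>j<Suc q. (- 1) ^ (j + 1) * (g (lower s j) - g (upper s j)))"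
proof -
  have delta: "(\<Sum>r\<in>cubes X n q. (if u = r then 1 else 0) * g r) = g u" if "u \<in> cubes X n q" for u
    using that finite_cubes[OF assms(1)] by (simp add: if_distrib[of "\<lambda>x. x * _"] cong: if_cong)
  have "(\<Sum>r\<in>cubes X n q. bcoef s r * g r) = (\<Sum>r\<in>cubes X n q. \<Sum>j<Suc q. (- 1) ^ (j + 1) *
      ((if lower s j = r then 1 else 0) * g r - (if upper s j = r then 1 else 0) * g r))"
    unfolding bcoef_faces cubesD(2)[OF assms(2)] sum_distrib_right
    by (intro sum.cong refl) (simp add: algebra_simps)
  also have "\<dots> = (\<Sum>j<Suc q. (- 1) ^ (j + 1) * (\<Sum>r\<in>cubes X n q.
      (if lower s j = r then 1 else 0) * g r - (if upper s j = r then 1 else 0) * g r))"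
    by (subst sum.swap) (simp only: sum_distrib_left)
  also have "\<dots> = (\<Sum>j<Suc q. (- 1) ^ (j + 1) * (g (lower s j) - g (upper s j)))"
    unfolding sum_subtractf using delta face_in_cubes[OF assms(2)] by (intro sum.cong refl) simp
  finally show ?thesis .
qed

section \<open>Cubes mapped onto cubes of the same dimension\<close>

lemma fcoef_delta:
  assumes r: "r \<in> cubes X n q" and r': "r' \<in> cubes X n q" and image: "f ` cpts r = cpts r'"
  shows "fcoef X n f r t = (if r' = t then fcoef X n f r r' else 0)"
  using fcoef_nonzeroD[OF r, of f t] cubes_unique[OF r', of t q] image by (cases "fcoef X n f r t = 0") auto

lemma image_restrict:
  assumes "f ` A = B" "\<And>x. x \<in> A \<Longrightarrow> P x \<longleftrightarrow> Q (f x)"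
  shows "f ` {x \<in> A. P x} = {y \<in> B. Q y}"
  using assms by blast

text \<open>Sign bookkeeping for a pair of opposite facets: \<open>m\<close> is the minor,
  \<open>d\<close> the full determinant, \<open>a\<close> and \<open>b\<close> are the facet signs
  in source and target. \<open>e = - 1\<close> accounts for the exchange of the lower and the upper
  facet.\<close>

lemma signed_diff:
  fixes a b d e m :: rat
  assumes "a * m = e * d * b"
  shows "a * ((if P then m else 0) - (if Q then m else 0))
    = d * (b * (e * ((if P then 1 else 0) - (if Q then 1 else 0))))"
  using assms by (cases P; cases Q) (simp_all add: mult.commute mult.left_commute)

text \<open>The two facets of \<open>s\<close> in direction \<open>p i\<close> go onto those of
  \<open>t\<close> in direction \<open>i\<close>, exchanged exactly when \<open>i \<in> E\<close>.
  The sign of \<open>f\<close> on them is the minor of \<open>M\<close> without row \<open>i\<close>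
  and column \<open>p i\<close>.\<close>

lemma chain_map_cube_image:
  assumes f: "c1_continuous X f" and fin: "finite X"
    and s: "s \<in> cubes X n (Suc q)" and t: "t \<in> cubes X n (Suc q)" and image: "f ` cpts s = cpts t"
  shows "(\<Sum>r\<in>cubes X n q. bcoef s r * fcoef X n f r u) = fcoef X n f s t * bcoef t u"
proof -
  note sD = cubesD[OF s] and tD = cubesD[OF t]
  obtain p E where p: "p permutes {..<Suc q}" and E: "E \<subseteq> {..<Suc q}" and pE: "signed_perm_on f s t (Suc q) p E"
    by (rule cube_map_signed_perm[OF f s t image])
  let ?\<epsilon> = "\<lambda>i. if i \<in> E then - 1 else 1 :: rat"
  obtain D where D: "has_jacobian f s D (set (nd t))"
    and D_entry: "\<And>i j. i < Suc q \<Longrightarrow> j < Suc q \<Longrightarrow> D (nd t ! i) (nd s ! j) = (if p i = j then ?\<epsilon> i else 0)"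
    by (rule has_jacobian_signed_perm[OF s t p pE]) (rule that)
  define M where "M = mat (Suc q) (Suc q) (\<lambda>(i, j). D (nd t ! i) (nd s ! j))"
  have M: "M \<in> carrier_mat (Suc q) (Suc q)" by (simp add: M_def)
  have det_M: "fcoef X n f s t = det M"
    unfolding M_def by (rule fcoef_eq_det[OF f s t image D])
  have p_lt: "p i < Suc q" if "i < Suc q" for i
    using permutes_in_image[OF p, of i] that by simp
  \<comment> \<open>Row \<open>i\<close> has its only nonzero entry in column \<open>p i\<close>, so
    the expansion along it is a single term.\<close>
  have laplace: "det M = ?\<epsilon> i * (- 1) ^ (i + p i) * det (mat_delete M i (p i))" if i: "i < Suc q" for i
  proof -
    have "det M = (\<Sum>j<Suc q. M $$ (i, j) * cofactor M i j)"
      by (rule laplace_expansion_row[OF M i])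
    also have "\<dots> = (\<Sum>j<Suc q. if j = p i then ?\<epsilon> i * cofactor M i (p i) else 0)"
      using i by (intro sum.cong) (auto simp: M_def D_entry)
    also have "\<dots> = ?\<epsilon> i * cofactor M i (p i)" using p_lt[OF i] by simp
    finally show ?thesis by (simp add: cofactor_def)
  qed
  have coord: "f x ! (nd t ! i) = fst (t ! (nd t ! i)) \<longleftrightarrow> (i \<in> E \<longleftrightarrow> x ! (nd s ! p i) \<noteq> fst (s ! (nd s ! p i)))"
    if i: "i < Suc q" and x: "x \<in> cpts s" for i x
  proof -
    obtain S where S: "S \<subseteq> {..<Suc q}" "x = vertex s S"
      using x bij_betw_vertex[OF sD(1)] sD(2) by (auto simp: bij_betw_def)
    have "f x = vertex t {i. i < Suc q \<and> ((i \<in> E) \<noteq> (p i \<in> S))}"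
      using bspec[OF pE, of S] S by simp
    then show ?thesis
      using vertex_nth_nd[of i t] vertex_nth_nd[of "p i" s S] i p_lt[OF i] sD(2) tD(2) S(2) by auto
  qed
  have minor: "fcoef X n f (face s (p i) v) (face t i v') = det (mat_delete M i (p i))"
    if i: "i < Suc q" and r: "face s (p i) v \<in> cubes X n q" "face t i v' \<in> cubes X n q"
      "cpts (face s (p i) v) \<subseteq> cpts s" "f ` cpts (face s (p i) v) = cpts (face t i v')" for i v v'
  proof -
    have "has_jacobian f (face s (p i) v) D (set (nd (face t i v')))"
      by (rule has_jacobian_mono[OF D r(3) _ set_nd_face_subset]) simp
    from fcoef_eq_det[OF f r(1,2,4) this]
    have "fcoef X n f (face s (p i) v) (face t i v')
      = det (mat q q (\<lambda>(k, l). D (nd (face t i v') ! k) (nd (face s (p i) v) ! l)))" .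
    also have "mat q q (\<lambda>(k, l). D (nd (face t i v') ! k) (nd (face s (p i) v) ! l)) = mat_delete M i (p i)"
      by (rule eq_matI) (use i p_lt[OF i] sD(2) tD(2) in \<open>auto simp: mat_delete_def M_def nd_face_nth\<close>)
    finally show ?thesis .
  qed
  have "(- 1) ^ (p i + 1) * (fcoef X n f (lower s (p i)) u - fcoef X n f (upper s (p i)) u)
      = det M * ((- 1) ^ (i + 1) * ((if lower t i = u then 1 else 0) - (if upper t i = u then 1 else 0)))"
    if i: "i < Suc q" for i
  proof -
    note pi = p_lt[OF i]
    note ls = face_in_cubes[OF s pi] and lt = face_in_cubes[OF t i]
    have j: "p i < cdim s" "i < cdim t" using i pi sD(2) tD(2) by simp_all
    have sub: "cpts (lower s (p i)) \<subseteq> cpts s" "cpts (upper s (p i)) \<subseteq> cpts s"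
      using cpts_lower[OF sD(1) j(1)] cpts_upper[OF sD(1) j(1)] by auto
    let ?m = "det (mat_delete M i (p i))"
    have sgn: "(- 1) ^ (p i + 1) * ?m = ?\<epsilon> i * det M * (- 1) ^ (i + 1)"
      using laplace[OF i] by (auto simp: power_add)
    show ?thesis
    proof (cases "i \<in> E")
      case True
      have im: "f ` cpts (lower s (p i)) = cpts (upper t i)" "f ` cpts (upper s (p i)) = cpts (lower t i)"
        unfolding cpts_lower[OF sD(1) j(1)] cpts_upper'[OF sD(1) j(1)] cpts_lower[OF tD(1) j(2)]
          cpts_upper'[OF tD(1) j(2)]
        by (rule image_restrict[OF image]; use coord[OF i] True in blast)+
      have "fcoef X n f (lower s (p i)) u = (if upper t i = u then ?m else 0)"
        using fcoef_delta[OF ls(1) lt(2) im(1), of u] unfolding minor[OF i ls(1) lt(2) sub(1) im(1)] .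
      moreover have "fcoef X n f (upper s (p i)) u = (if lower t i = u then ?m else 0)"
        using fcoef_delta[OF ls(2) lt(1) im(2), of u] unfolding minor[OF i ls(2) lt(1) sub(2) im(2)] .
      ultimately show ?thesis using signed_diff[OF sgn] True by simp
    next
      case False
      have im: "f ` cpts (lower s (p i)) = cpts (lower t i)" "f ` cpts (upper s (p i)) = cpts (upper t i)"
        unfolding cpts_lower[OF sD(1) j(1)] cpts_upper'[OF sD(1) j(1)] cpts_lower[OF tD(1) j(2)]
          cpts_upper'[OF tD(1) j(2)]
        by (rule image_restrict[OF image]; use coord[OF i] False in blast)+
      have "fcoef X n f (lower s (p i)) u = (if lower t i = u then ?m else 0)"
        using fcoef_delta[OF ls(1) lt(1) im(1), of u] unfolding minor[OF i ls(1) lt(1) sub(1) im(1)] .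
      moreover have "fcoef X n f (upper s (p i)) u = (if upper t i = u then ?m else 0)"
        using fcoef_delta[OF ls(2) lt(2) im(2), of u] unfolding minor[OF i ls(2) lt(2) sub(2) im(2)] .
      ultimately show ?thesis using signed_diff[OF sgn] False by simp
    qed
  qed
  then have "(\<Sum>i<Suc q. (- 1) ^ (p i + 1) * (fcoef X n f (lower s (p i)) u - fcoef X n f (upper s (p i)) u))
    = det M * bcoef t u"
    unfolding bcoef_faces tD(2) sum_distrib_left by (intro sum.cong) auto
  \<comment> \<open>The directions of \<open>s\<close> are reordered by \<open>p\<close> to match
    those of \<open>t\<close>.\<close>
  moreover have "(\<Sum>i<Suc q. (- 1) ^ (p i + 1) * (fcoef X n f (lower s (p i)) u - fcoef X n f (upper s (p i)) u))
    = (\<Sum>j<Suc q. (- 1) ^ (j + 1) * (fcoef X n f (lower s j) u - fcoef X n f (upper s j) u))"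
    by (rule sum.reindex_bij_betw[OF permutes_imp_bij[OF p]])
  ultimately show ?thesis using sum_bcoef[OF fin s] det_M by simp
qed


section \<open>Cubes whose image is not a cube of the same dimension\<close>

lemma adjacent_points_edge:
  assumes adj: "c1_adj x y" and len: "length x = n"
  obtains T where "elem_cube n T" "cdim T = 1" "cpts T = {x, y}"
proof -
  have len': "length y = n" using adj len by (simp add: c1_adj_def)
  obtain k where k: "k < n" "\<bar>x ! k - y ! k\<bar> = 1" and eq: "\<And>j. j < n \<Longrightarrow> j \<noteq> k \<Longrightarrow> x ! j = y ! j"
    using adj unfolding c1_adj_def len by blast
  define T where "T = map (\<lambda>i. (min (x ! i) (y ! i), max (x ! i) (y ! i))) [0..<n]"
  have elem: "elem_cube n T"
    unfolding elem_cube_def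
  proof (intro conjI allI impI)
    fix i assume "i < n"
    then show "snd (T ! i) = fst (T ! i) \<or> snd (T ! i) = fst (T ! i) + 1"
      using k eq[of i] by (cases "i = k") (auto simp: T_def min_def max_def)
  qed (simp add: T_def)
  have "z = x \<or> z = y" if "z \<in> cpts T" for z
  proof -
    have z: "length z = n" "\<And>i. i < n \<Longrightarrow> min (x ! i) (y ! i) \<le> z ! i \<and> z ! i \<le> max (x ! i) (y ! i)"
      using that by (auto simp: cpts_def T_def)
    have zi: "z ! i = x ! i" "z ! i = y ! i" if "i < n" "i \<noteq> k" for i
      using z(2)[OF that(1)] eq[OF that] by auto
    have "z ! k = x ! k \<or> z ! k = y ! k" using z(2)[OF k(1)] k(2) by linarith
    then show ?thesis
    proof
      assume zk: "z ! k = x ! k"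
      have "z ! i = x ! i" if "i < n" for i using zk zi(1)[OF that] by (cases "i = k") simp_all
      then have "z = x" using z(1) len by (simp add: nth_equalityI)
      then show ?thesis ..
    next
      assume zk: "z ! k = y ! k"
      have "z ! i = y ! i" if "i < n" for i using zk zi(2)[OF that] by (cases "i = k") simp_all
      then have "z = y" using z(1) len' by (simp add: nth_equalityI)
      then show ?thesis ..
    qed
  qed
  moreover have "x \<in> cpts T" "y \<in> cpts T" using len len' by (auto simp: cpts_def T_def)
  ultimately have pts: "cpts T = {x, y}" by blast
  have "x \<noteq> y" using k by auto
  then have "(2::nat) ^ cdim T = 2 ^ 1" using card_cpts[OF elem] pts by simp
  then have "cdim T = 1" by (subst (asm) power_inject_exp) simp_all
  with elem pts show ?thesis using that by blast
qed

lemma fcoef_dim_0: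
  assumes f: "c1_continuous X f" and s: "s \<in> cubes X n 0"
  shows "fcoef X n f s t = (if t \<in> cubes X n 0 \<and> f ` cpts s = cpts t then 1 else 0)"
proof (cases "t \<in> cubes X n 0 \<and> f ` cpts s = cpts t")
  case True
  then obtain p E where p: "p permutes {..<0}" and "E \<subseteq> {..<0}" "signed_perm_on f s t 0 p E"
    using cube_map_signed_perm[OF f s] by blast
  then have "fcoef X n f s t = of_int (sign p) * (- 1) ^ card E"
    using fcoef_signed_perm[OF s] True by blast
  moreover have "p = id" "E = {}" using p \<open>E \<subseteq> _\<close> by simp_all
  ultimately show ?thesis using True by (simp add: sign_id)
next
  case False
  then show ?thesis using fcoef_nonzeroD[OF s, of f t] by auto
qed

text \<open>If the ends of the edge had different images, these would span an edge; so the images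
  agree and the two contributions cancel. Dimension 1 is treated apart because
  \<open>small_cycle_contains_cube\<close> concerns cycles of positive degree.\<close>

lemma chain_map_edge:
  assumes f: "c1_continuous X f" and fin: "finite X" and len: "\<forall>x\<in>X. length x = n"
    and s: "s \<in> cubes X n 1" and no_cube: "\<And>w. w \<in> cubes X n 1 \<Longrightarrow> f ` cpts s \<noteq> cpts w"
  shows "(\<Sum>r\<in>cubes X n 0. bcoef s r * fcoef X n f r t) = 0"
proof -
  note sD = cubesD[OF s]
  have s': "s \<in> cubes X n (Suc 0)" using s by simp
  have dim: "0 < cdim s" using sD(2) by simp
  let ?x = "vertex s {}" and ?y = "vertex s {0}"
  have pts: "cpts s = {?x, ?y}"
    using bij_betw_imp_surj_on[OF bij_betw_vertex[OF sD(1)]] sD(2)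
    by (simp add: lessThan_Suc Pow_insert) blast
  have xy: "?x \<in> X" "?y \<in> X" using pts sD(3) by auto
  have adj: "c1_adj ?x ?y" using c1_adj_vertex_insert[OF sD(1), of 0 "{}"] sD(2) by simp
  have lower: "cpts (lower s 0) = {?x}" and upper: "cpts (upper s 0) = {?y}"
    using vertex_nth_nd[OF dim, of "{}"] vertex_nth_nd[OF dim, of "{0}"]
    unfolding cpts_lower[OF sD(1) dim] cpts_upper'[OF sD(1) dim] pts by auto
  have fxy: "f ?x \<in> X" "f ?y \<in> X" using f xy by (auto simp: c1_continuous_def)
  have "f ?x = f ?y"
  proof (rule ccontr)
    assume "f ?x \<noteq> f ?y"
    then have "c1_adj (f ?x) (f ?y)" using f xy adj by (auto simp: c1_continuous_def)
    then obtain T where T: "elem_cube n T" "cdim T = 1" "cpts T = {f ?x, f ?y}"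
      using adjacent_points_edge len fxy by metis
    then have "T \<in> cubes X n 1" using fxy by (auto simp: cubes_def)
    then show False using no_cube[of T] pts T(3) by simp
  qed
  then have "fcoef X n f (lower s 0) t = fcoef X n f (upper s 0) t"
    using fcoef_dim_0[OF f face_in_cubes(1)[OF s', of 0]] fcoef_dim_0[OF f face_in_cubes(2)[OF s', of 0]]
      lower upper by simp
  then show ?thesis using sum_bcoef[OF fin s'] by simp
qed

lemma bcoef_face_in_cubes:
  assumes "s \<in> cubes X n (Suc q)" "bcoef s r \<noteq> 0"
  shows "r \<in> cubes X n q" "cpts r \<subseteq> cpts s"
proof -
  obtain j where j: "j < cdim s" "r = lower s j \<or> r = upper s j"
    using bcoef_nonzeroD[OF assms(2)] by blast
  note sD = cubesD[OF assms(1)]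
  show "r \<in> cubes X n q" using face_in_cubes[OF assms(1)] j sD(2) by auto
  show "cpts r \<subseteq> cpts s"
    using j(2) cpts_lower[OF sD(1) j(1)] cpts_upper[OF sD(1) j(1)] by auto
qed

text \<open>Facets of cubes in \<open>X\<close> stay in \<open>X\<close>, so \<open>bd_bd\<close>
  carries over to sums restricted to \<open>X\<close>.\<close>

lemma sum_bcoef_bcoef:
  assumes "finite X" "s \<in> cubes X n (Suc q)"
  shows "(\<Sum>r\<in>cubes X n q. bcoef s r * bcoef r y) = 0"
proof -
  have "bd (bcoef s) y = (\<Sum>r\<in>cubes X n q. bcoef s r * bcoef r y)"
    by (rule bd_eq_sum_bcoef[OF finite_cubes[OF assms(1)]])
      (use bcoef_face_in_cubes[OF assms(2)] cubesD(1) in blast)+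
  moreover have "bcoef s = bd (\<lambda>u. if u = s then 1 else 0)"
    using bcoef_eq_bd[OF cubesD(1)[OF assms(2)]] by (rule ext)
  ultimately show ?thesis by (simp add: bd_bd)
qed

lemma card_facets: "finite {r. bcoef s r \<noteq> 0} \<and> card {r. bcoef s r \<noteq> 0} \<le> 2 * cdim s"
proof -
  let ?F = "lower s ` {..<cdim s} \<union> upper s ` {..<cdim s}"
  have sub: "{r. bcoef s r \<noteq> 0} \<subseteq> ?F" using bcoef_nonzeroD by fast
  have "card ?F \<le> card (lower s ` {..<cdim s}) + card (upper s ` {..<cdim s})" by (rule card_Un_le)
  also have "\<dots> \<le> cdim s + cdim s"
    using card_image_le[of "{..<cdim s}" "lower s"] card_image_le[of "{..<cdim s}" "upper s"]
    by (intro add_mono) simp_all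
  finally have "card ?F \<le> 2 * cdim s" by simp
  moreover have "finite ?F" by simp
  ultimately show ?thesis using card_mono[OF _ sub] finite_subset[OF sub] by fastforce
qed

lemma image_cube_unique_coef:
  assumes fin: "finite X" and s: "s \<in> cubes X n q" and w: "w \<in> cubes X n q" and image: "f ` cpts s = cpts w"
  shows "(\<Sum>v\<in>cubes X n q. fcoef X n f s v * g v) = fcoef X n f s w * g w"
proof -
  have "(\<Sum>v\<in>cubes X n q. fcoef X n f s v * g v) = (\<Sum>v\<in>cubes X n q. if w = v then fcoef X n f s w * g w else 0)"
  proof (rule sum.cong[OF refl])
    fix v
    show "fcoef X n f s v * g v = (if w = v then fcoef X n f s w * g w else 0)"
      using fcoef_delta[OF s w image, of v] by (cases "w = v") simp_all
  qed
  also have "\<dots> = fcoef X n f s w * g w" using w finite_cubes[OF fin] by simp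
  finally show ?thesis .
qed

lemma chain_map_no_cube_image:
  assumes f: "c1_continuous X f" and fin: "finite X"
    and IH: "\<And>r t. r \<in> cubes X n (Suc q) \<Longrightarrow> (\<Sum>y\<in>cubes X n q. bcoef r y * fcoef X n f y t)
      = (\<Sum>w\<in>cubes X n (Suc q). fcoef X n f r w * bcoef w t)"
    and s: "s \<in> cubes X n (Suc (Suc q))"
    and no_cube: "\<And>w. w \<in> cubes X n (Suc (Suc q)) \<Longrightarrow> f ` cpts s \<noteq> cpts w"
  shows "(\<Sum>r\<in>cubes X n (Suc q). bcoef s r * fcoef X n f r t) = 0"
proof -
  note sD = cubesD[OF s]
  let ?Q = "cubes X n (Suc q)"
  note finQ = finite_cubes[OF fin, of n "Suc q"]
  define c where "c t = (\<Sum>r\<in>?Q. bcoef s r * fcoef X n f r t)" for t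
  have supp: "\<exists>r. bcoef s r \<noteq> 0 \<and> r \<in> ?Q \<and> t \<in> ?Q \<and> f ` cpts r = cpts t" if c: "c t \<noteq> 0" for t
  proof -
    obtain r where "r \<in> ?Q" "bcoef s r * fcoef X n f r t \<noteq> 0"
      using c unfolding c_def by (rule sum.not_neutral_contains_not_neutral)
    then show ?thesis using fcoef_nonzeroD[of r X n "Suc q" f t] by auto
  qed
  have chain: "cubical_chain n (Suc q) c"
    unfolding cubical_chain_def
  proof (intro conjI allI impI)
    show "finite {t. c t \<noteq> 0}" by (rule finite_subset[OF _ finQ]) (use supp in blast)
    fix t assume "c t \<noteq> 0"
    then have "t \<in> ?Q" using supp by blast
    then show "elem_cube n t" "cdim t = Suc q" by (rule cubesD)+
  qed
  \<comment> \<open>The induction hypothesis moves the boundary past \<open>f\<close> on each facet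
    of \<open>s\<close>; what remains is the boundary of the boundary of \<open>s\<close>.\<close>
  have cycle: "bd c t = 0" for t
  proof -
    have "bd c t = (\<Sum>r\<in>?Q. bcoef s r * bd (fcoef X n f r) t)"
      unfolding c_def bd_sum bd_scale ..
    also have "\<dots> = (\<Sum>r\<in>?Q. bcoef s r * (\<Sum>y\<in>cubes X n q. bcoef r y * fcoef X n f y t))"
    proof (rule sum.cong[OF refl])
      fix r assume r: "r \<in> ?Q"
      have "bd (fcoef X n f r) t = (\<Sum>w\<in>?Q. fcoef X n f r w * bcoef w t)"
        by (rule bd_eq_sum_bcoef[OF finQ]) (use fcoef_nonzeroD(1)[OF r] cubesD(1) in blast)+
      then show "bcoef s r * bd (fcoef X n f r) t = bcoef s r * (\<Sum>y\<in>cubes X n q. bcoef r y * fcoef X n f y t)"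
        by (simp add: IH[OF r])
    qed
    also have "\<dots> = (\<Sum>y\<in>cubes X n q. (\<Sum>r\<in>?Q. bcoef s r * bcoef r y) * fcoef X n f y t)"
      unfolding sum_distrib_left sum_distrib_right by (subst sum.swap) (simp only: mult.assoc)
    also have "\<dots> = 0" by (simp add: sum_bcoef_bcoef[OF fin s])
    finally show ?thesis .
  qed
  have "card {t. c t \<noteq> 0} \<le> 2 * Suc (Suc q)"
  proof -
    let ?F = "{r. bcoef s r \<noteq> 0}"
    \<comment> \<open>Each facet yields at most one cell, the cube onto which it is mapped. If there
      is none the chosen value is arbitrary, which can only enlarge the image of
      \<open>?h\<close>.\<close>
    let ?h = "\<lambda>r. SOME t. t \<in> ?Q \<and> f ` cpts r = cpts t"
    have "{t. c t \<noteq> 0} \<subseteq> ?h ` ?F"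
    proof
      fix t assume "t \<in> {t. c t \<noteq> 0}"
      then obtain r where r: "bcoef s r \<noteq> 0" "t \<in> ?Q \<and> f ` cpts r = cpts t" using supp by blast
      have "?h r \<in> ?Q \<and> f ` cpts r = cpts (?h r)" by (rule someI[of _ t]) (rule r(2))
      then have "?h r = t" using r(2) cubes_unique by metis
      then show "t \<in> ?h ` ?F" using r(1) by blast
    qed
    then have "card {t. c t \<noteq> 0} \<le> card (?h ` ?F)"
      using card_facets[of s] by (intro card_mono) auto
    also have "\<dots> \<le> card ?F" using card_facets[of s] by (intro card_image_le) auto
    also have "\<dots> \<le> 2 * cdim s" using card_facets[of s] by blast
    finally show ?thesis by (simp only: sD(2))
  qed
  note small = small_cycle_contains_cube[OF chain cycle _ this]
  have "c = (\<lambda>_. 0)"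
  proof (rule ccontr)
    assume "c \<noteq> (\<lambda>_. 0)"
    then obtain T where T: "elem_cube n T" "cdim T = Suc (Suc q)"
      "\<And>x. x \<in> cpts T \<Longrightarrow> \<exists>t. c t \<noteq> 0 \<and> x \<in> cpts t"
      using small by blast
    have sub: "cpts T \<subseteq> f ` cpts s"
    proof
      fix x assume "x \<in> cpts T"
      then obtain t where t: "c t \<noteq> 0" "x \<in> cpts t" using T(3) by blast
      then obtain r where r: "bcoef s r \<noteq> 0" "f ` cpts r = cpts t" using supp by blast
      then show "x \<in> f ` cpts s" using t(2) bcoef_face_in_cubes(2)[OF s r(1)] by blast
    qed
    \<comment> \<open>\<open>T\<close> has as many points as \<open>s\<close>, hence at least as
      many as the image of \<open>s\<close>; this turns the inclusion into an equality.\<close>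
    have "card (f ` cpts s) \<le> card (cpts T)"
      using card_image_le[OF finite_cpts[OF sD(1)], of f] card_cpts[OF sD(1)] card_cpts[OF T(1)] T(2) sD(2)
      by simp
    then have eq: "cpts T = f ` cpts s"
      using card_seteq[OF finite_imageI[OF finite_cpts[OF sD(1)]] sub] by blast
    have "f ` cpts s \<subseteq> X" using f sD(3) unfolding c1_continuous_def by blast
    then have "T \<in> cubes X n (Suc (Suc q))" using T(1,2) eq by (simp add: cubes_def)
    then show False using no_cube[of T] eq by simp
  qed
  then show ?thesis using c_def by metis
qed

lemma chain_map_coef:
  assumes f: "c1_continuous X f" and fin: "finite X" and len: "\<forall>x\<in>X. length x = n"
    and s: "s \<in> cubes X n (Suc q)"
  shows "(\<Sum>r\<in>cubes X n q. bcoef s r * fcoef X n f r t)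
    = (\<Sum>w\<in>cubes X n (Suc q). fcoef X n f s w * bcoef w t)"
  using s
proof (induction q arbitrary: s t)
  case (0 s t)
  show ?case
  proof (cases "\<exists>w\<in>cubes X n (Suc 0). f ` cpts s = cpts w")
    case True
    then obtain w where w: "w \<in> cubes X n (Suc 0)" "f ` cpts s = cpts w" by blast
    show ?thesis
      using chain_map_cube_image[OF f fin 0 w] image_cube_unique_coef[OF fin 0 w] by simp
  next
    case False
    then have "fcoef X n f s w = 0" for w using fcoef_nonzeroD[OF 0, of f w] by blast
    moreover have "(\<Sum>r\<in>cubes X n 0. bcoef s r * fcoef X n f r t) = 0"
      by (rule chain_map_edge[OF f fin len]) (use 0 False in auto)
    ultimately show ?thesis by simp
  qed
next
  case (Suc q s t)
  show ?case
  proof (cases "\<exists>w\<in>cubes X n (Suc (Suc q)). f ` cpts s = cpts w")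
    case True
    then obtain w where w: "w \<in> cubes X n (Suc (Suc q))" "f ` cpts s = cpts w" by blast
    show ?thesis
      using chain_map_cube_image[OF f fin Suc.prems w] image_cube_unique_coef[OF fin Suc.prems w] by simp
  next
    case False
    then have "fcoef X n f s w = 0" for w using fcoef_nonzeroD[OF Suc.prems, of f w] by blast
    moreover have "(\<Sum>r\<in>cubes X n (Suc q). bcoef s r * fcoef X n f r t) = 0"
      by (rule chain_map_no_cube_image[OF f fin Suc.IH Suc.prems]) (use False in auto)
    ultimately show ?thesis by simp
  qed
qed

section \<open>Traces on quotient spaces\<close>

definition lin_subspace :: "('a \<Rightarrow> rat) set \<Rightarrow> bool" where
  "lin_subspace V \<longleftrightarrow> (\<lambda>_. 0) \<in> V \<and> (\<forall>u\<in>V. \<forall>v\<in>V. (\<lambda>x. u x + v x) \<in> V) \<and> (\<forall>a. \<forall>v\<in>V. (\<lambda>x. a * v x) \<in> V)"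

definition lin_map :: "(('a \<Rightarrow> rat) \<Rightarrow> ('b \<Rightarrow> rat)) \<Rightarrow> bool" where
  "lin_map g \<longleftrightarrow> (\<forall>u v. g (\<lambda>x. u x + v x) = (\<lambda>x. g u x + g v x)) \<and> (\<forall>a v. g (\<lambda>x. a * v x) = (\<lambda>x. a * g v x))"

lemma lin_subspace_zero: "lin_subspace V \<Longrightarrow> (\<lambda>_. 0) \<in> V"
  and lin_subspace_add: "lin_subspace V \<Longrightarrow> u \<in> V \<Longrightarrow> v \<in> V \<Longrightarrow> (\<lambda>x. u x + v x) \<in> V"
  and lin_subspace_scale: "lin_subspace V \<Longrightarrow> v \<in> V \<Longrightarrow> (\<lambda>x. a * v x) \<in> V"
  by (simp_all add: lin_subspace_def)

lemma lin_subspace_diff: "lin_subspace V \<Longrightarrow> u \<in> V \<Longrightarrow> v \<in> V \<Longrightarrow> (\<lambda>x. u x - v x) \<in> V"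
  using lin_subspace_add[of V u "\<lambda>x. - 1 * v x"] lin_subspace_scale[of V v "- 1"] by simp

lemma lin_subspace_sum:
  assumes "lin_subspace V" "\<And>i. i \<in> I \<Longrightarrow> v i \<in> V"
  shows "(\<lambda>x. \<Sum>i\<in>I. a i * v i x) \<in> V"
  using assms(2)
proof (induction I rule: infinite_finite_induct)
  case (insert i I)
  then show ?case
    using lin_subspace_add[OF assms(1) lin_subspace_scale[OF assms(1), of "v i" "a i"]] by simp
qed (simp_all add: lin_subspace_zero[OF assms(1)])

lemma lincomb_in_subspace: "lin_subspace V \<Longrightarrow> set bs \<subseteq> V \<Longrightarrow> lincomb a bs \<in> V"
  unfolding lincomb_def by (rule lin_subspace_sum) auto

lemma lin_map_add: "lin_map g \<Longrightarrow> g (\<lambda>x. u x + v x) = (\<lambda>x. g u x + g v x)"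
  and lin_map_scale: "lin_map g \<Longrightarrow> g (\<lambda>x. a * v x) = (\<lambda>x. a * g v x)"
  by (simp_all add: lin_map_def)

lemma lin_map_zero: "lin_map g \<Longrightarrow> g (\<lambda>_. 0) = (\<lambda>_. 0)"
  using lin_map_scale[of g 0 "\<lambda>_. 0"] by simp

lemma lin_map_diff: "lin_map g \<Longrightarrow> g (\<lambda>x. u x - v x) = (\<lambda>x. g u x - g v x)"
  using lin_map_add[of g u "\<lambda>x. - 1 * v x"] lin_map_scale[of g "- 1" v] by simp

lemma lin_map_sum:
  assumes "lin_map g"
  shows "g (\<lambda>x. \<Sum>i\<in>I. a i * v i x) = (\<lambda>x. \<Sum>i\<in>I. a i * g (v i) x)"
proof (induction I rule: infinite_finite_induct)
  case (insert i I)
  then show ?case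
    using lin_map_add[OF assms, of "\<lambda>x. a i * v i x" "\<lambda>x. \<Sum>i\<in>I. a i * v i x"]
    by (simp add: lin_map_scale[OF assms])
qed (simp_all add: lin_map_zero[OF assms])

lemma lin_map_lincomb: "lin_map g \<Longrightarrow> g (lincomb a bs) = lincomb a (map g bs)"
  unfolding lincomb_def by (simp add: lin_map_sum)

text \<open>Quotient spaces are never formed; all computations in \<open>Z\<close> modulo
  \<open>B\<close> use representatives.\<close>

definition cong_mod :: "('a \<Rightarrow> rat) set \<Rightarrow> ('a \<Rightarrow> rat) \<Rightarrow> ('a \<Rightarrow> rat) \<Rightarrow> bool" where
  "cong_mod B u v \<longleftrightarrow> (\<lambda>x. u x - v x) \<in> B"

lemma cong_mod_eqI: "u = v \<Longrightarrow> cong_mod {\<lambda>_. 0} u v"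
  by (simp add: cong_mod_def)

lemma cong_mod_sym: "lin_subspace B \<Longrightarrow> cong_mod B u v \<Longrightarrow> cong_mod B v u"
  using lin_subspace_scale[of B "\<lambda>x. u x - v x" "- 1"] by (simp add: cong_mod_def)

lemma cong_mod_trans: "lin_subspace B \<Longrightarrow> cong_mod B u v \<Longrightarrow> cong_mod B v w \<Longrightarrow> cong_mod B u w"
  using lin_subspace_add[of B "\<lambda>x. u x - v x" "\<lambda>x. v x - w x"] by (simp add: cong_mod_def)

lemma cong_mod_sum:
  assumes "lin_subspace B" "\<And>i. i \<in> I \<Longrightarrow> cong_mod B (u i) (v i)"
  shows "cong_mod B (\<lambda>x. \<Sum>i\<in>I. a i * u i x) (\<lambda>x. \<Sum>i\<in>I. a i * v i x)"
  using lin_subspace_sum[OF assms(1), of I "\<lambda>i x. u i x - v i x" a] assms(2)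
  by (simp add: cong_mod_def right_diff_distrib sum_subtractf)

lemma cong_mod_map:
  assumes "lin_map g" "\<And>b. b \<in> B \<Longrightarrow> g b \<in> B" "cong_mod B u v"
  shows "cong_mod B (g u) (g v)"
  using assms(2)[of "\<lambda>x. u x - v x"] assms(3) by (simp add: cong_mod_def lin_map_diff[OF assms(1)])

lemma lincomb_cong: "(\<And>i. i < length bs \<Longrightarrow> a i = b i) \<Longrightarrow> lincomb a bs = lincomb b bs"
  by (auto simp: lincomb_def fun_eq_iff intro!: sum.cong)

lemma lincomb_delta:
  assumes "i < length bs"
  shows "lincomb (\<lambda>j. if j = i then 1 else 0) bs = bs ! i"
proof
  fix x
  have "lincomb (\<lambda>j. if j = i then 1 else 0) bs x = (\<Sum>j<length bs. if j = i then (bs ! j) x else 0)"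
    unfolding lincomb_def by (rule sum.cong) auto
  then show "lincomb (\<lambda>j. if j = i then 1 else 0) bs x = (bs ! i) x" using assms by simp
qed

text \<open>The new coefficients are the product of the row \<open>a\<close> with the matrix
  \<open>P\<close>, so repeated substitution becomes matrix multiplication.\<close>

lemma lincomb_substitute:
  assumes "lin_subspace B" "\<And>i. i < length cs \<Longrightarrow> cong_mod B (cs ! i) (lincomb (P i) bs)"
  shows "cong_mod B (lincomb a cs) (lincomb (\<lambda>j. \<Sum>i<length cs. a i * P i j) bs)"
proof -
  have "cong_mod B (lincomb a cs) (\<lambda>x. \<Sum>i<length cs. a i * lincomb (P i) bs x)"
    unfolding lincomb_def[of a] using assms by (intro cong_mod_sum) auto
  moreover have "(\<lambda>x. \<Sum>i<length cs. a i * lincomb (P i) bs x) = lincomb (\<lambda>j. \<Sum>i<length cs. a i * P i j) bs"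
  proof
    fix x
    have "(\<Sum>i<length cs. a i * lincomb (P i) bs x)
      = (\<Sum>i<length cs. \<Sum>j<length bs. a i * P i j * (bs ! j) x)"
      by (simp add: lincomb_def sum_distrib_left mult.assoc)
    also have "\<dots> = (\<Sum>j<length bs. \<Sum>i<length cs. a i * P i j * (bs ! j) x)" by (rule sum.swap)
    finally show "(\<Sum>i<length cs. a i * lincomb (P i) bs x) = lincomb (\<lambda>j. \<Sum>i<length cs. a i * P i j) bs x"
      by (simp add: lincomb_def sum_distrib_right)
  qed
  ultimately show ?thesis by simp
qed

text \<open>Representatives of a basis of the quotient; with \<open>has_trace\<close> it isolates
  the condition under the choice in \<open>quot_trace\<close>.\<close>

definition basis_mod :: "('a \<Rightarrow> rat) list \<Rightarrow> ('a \<Rightarrow> rat) set \<Rightarrow> ('a \<Rightarrow> rat) set \<Rightarrow> bool" where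
  "basis_mod bs Z B \<longleftrightarrow> set bs \<subseteq> Z \<and>
      (\<forall>a. lincomb a bs \<in> B \<longrightarrow> (\<forall>i<length bs. a i = 0)) \<and>
      (\<forall>z\<in>Z. \<exists>a. cong_mod B z (lincomb a bs))"

definition has_trace :: "(('a \<Rightarrow> rat) \<Rightarrow> ('a \<Rightarrow> rat)) \<Rightarrow> ('a \<Rightarrow> rat) set \<Rightarrow> ('a \<Rightarrow> rat) set \<Rightarrow> rat \<Rightarrow> bool" where
  "has_trace g Z B t \<longleftrightarrow> (\<exists>bs M. basis_mod bs Z B \<and>
      (\<forall>i<length bs. cong_mod B (g (bs ! i)) (lincomb (M i) bs)) \<and> t = (\<Sum>i<length bs. M i i))"

lemma quot_trace_eq_SOME: "quot_trace g Z B = (SOME t. has_trace g Z B t)"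
  unfolding quot_trace_def has_trace_def basis_mod_def cong_mod_def by (simp only: conj_assoc)

lemma basis_mod_span: "basis_mod bs Z B \<Longrightarrow> z \<in> Z \<Longrightarrow> \<exists>a. cong_mod B z (lincomb a bs)"
  by (simp add: basis_mod_def)

lemma basis_mod_unique_coeffs:
  assumes "basis_mod bs Z B" "cong_mod B (lincomb a bs) (lincomb b bs)" "i < length bs"
  shows "a i = b i"
proof -
  have "(\<lambda>x. lincomb a bs x - lincomb b bs x) = lincomb (\<lambda>i. a i - b i) bs"
    by (simp add: fun_eq_iff lincomb_def left_diff_distrib sum_subtractf)
  then have "lincomb (\<lambda>i. a i - b i) bs \<in> B" using assms(2) by (simp add: cong_mod_def)
  then have "a i - b i = 0" using assms(1,3) unfolding basis_mod_def by blast
  then show ?thesis by simp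
qed

text \<open>Expanding \<open>cs\<close> in \<open>bs\<close> and back again gives \<open>cs\<close>;
  uniqueness of coefficients turns this into a matrix identity.\<close>

lemma change_of_basis_inverse:
  assumes B: "lin_subspace B" and cs: "basis_mod cs Z B"
    and P: "\<And>i. i < length cs \<Longrightarrow> cong_mod B (cs ! i) (lincomb (P i) bs)"
    and Q: "\<And>j. j < length bs \<Longrightarrow> cong_mod B (bs ! j) (lincomb (Q j) cs)"
    and ik: "i < length cs" "k < length cs"
  shows "(\<Sum>j<length bs. P i j * Q j k) = (if k = i then 1 else 0)"
proof -
  have "cong_mod B (cs ! i) (lincomb (\<lambda>k. \<Sum>j<length bs. P i j * Q j k) cs)"
    using cong_mod_trans[OF B P[OF ik(1)] lincomb_substitute[OF B Q]] .
  then have "cong_mod B (lincomb (\<lambda>k. if k = i then 1 else 0) cs) (lincomb (\<lambda>k. \<Sum>j<length bs. P i j * Q j k) cs)"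
    by (simp only: lincomb_delta[OF ik(1)])
  from basis_mod_unique_coeffs[OF cs this ik(2)] show ?thesis by simp
qed

text \<open>With the base changes \<open>P\<close> and \<open>Q\<close>, tr N = tr (N P Q) = tr (P M
  Q) = tr (M Q P) = tr M. The two lists may differ in length a priori, so \<open>P Q = 1\<close> and
  \<open>Q P = 1\<close> are established separately.\<close>

lemma has_trace_unique:
  assumes B: "lin_subspace B" and g: "lin_map g" and gB: "\<And>b. b \<in> B \<Longrightarrow> g b \<in> B"
    and "has_trace g Z B t" "has_trace g Z B t'"
  shows "t = t'"
proof -
  obtain bs M where bs: "basis_mod bs Z B" and M: "\<And>i. i < length bs \<Longrightarrow> cong_mod B (g (bs ! i)) (lincomb (M i) bs)"
    and t: "t = (\<Sum>i<length bs. M i i)"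
    using assms(4) unfolding has_trace_def by blast
  obtain cs N where cs: "basis_mod cs Z B" and N: "\<And>i. i < length cs \<Longrightarrow> cong_mod B (g (cs ! i)) (lincomb (N i) cs)"
    and t': "t' = (\<Sum>i<length cs. N i i)"
    using assms(5) unfolding has_trace_def by blast
  let ?m = "length bs" and ?k = "length cs"
  have "\<forall>i. \<exists>a. i < ?k \<longrightarrow> cong_mod B (cs ! i) (lincomb a bs)"
    using bs cs nth_mem[of _ cs] unfolding basis_mod_def by blast
  then obtain P where P: "\<And>i. i < ?k \<Longrightarrow> cong_mod B (cs ! i) (lincomb (P i) bs)" by metis
  have "\<forall>i. \<exists>a. i < ?m \<longrightarrow> cong_mod B (bs ! i) (lincomb a cs)"
    using bs cs nth_mem[of _ bs] unfolding basis_mod_def by blast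
  then obtain Q where Q: "\<And>i. i < ?m \<Longrightarrow> cong_mod B (bs ! i) (lincomb (Q i) cs)" by metis
  have PQ: "(\<Sum>j<?m. P i j * Q j k) = (if k = i then 1 else 0)" if "i < ?k" "k < ?k" for i k
    by (rule change_of_basis_inverse[OF B cs P Q that])
  have QP: "(\<Sum>j<?k. Q i j * P j k) = (if k = i then 1 else 0)" if "i < ?m" "k < ?m" for i k
    by (rule change_of_basis_inverse[OF B bs Q P that])
  \<comment> \<open>The relation \<open>N P = P M\<close>: both sides are the coefficients of
    \<open>g (cs ! i)\<close> with respect to \<open>bs\<close>.\<close>
  have NP: "(\<Sum>k<?k. N i k * P k l) = (\<Sum>j<?m. P i j * M j l)" if i: "i < ?k" and l: "l < ?m" for i l
  proof -
    have 1: "cong_mod B (g (cs ! i)) (lincomb (\<lambda>l. \<Sum>k<?k. N i k * P k l) bs)"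
      using cong_mod_trans[OF B N[OF i] lincomb_substitute[OF B P]] .
    have "cong_mod B (g (cs ! i)) (lincomb (P i) (map g bs))"
      using cong_mod_map[OF g gB P[OF i]] by (simp only: lin_map_lincomb[OF g])
    moreover have "cong_mod B (lincomb (P i) (map g bs)) (lincomb (\<lambda>l. \<Sum>j<length (map g bs). P i j * M j l) bs)"
      by (rule lincomb_substitute[OF B]) (simp add: M)
    ultimately have "cong_mod B (g (cs ! i)) (lincomb (\<lambda>l. \<Sum>j<?m. P i j * M j l) bs)"
      using cong_mod_trans[OF B] by (metis length_map)
    then have "cong_mod B (lincomb (\<lambda>l. \<Sum>k<?k. N i k * P k l) bs) (lincomb (\<lambda>l. \<Sum>j<?m. P i j * M j l) bs)"
      using cong_mod_trans[OF B cong_mod_sym[OF B 1]] by blast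
    from basis_mod_unique_coeffs[OF bs this l] show ?thesis .
  qed
  have "t' = (\<Sum>i<?k. \<Sum>k<?k. N i k * (if i = k then 1 else 0))"
    unfolding t' by (intro sum.cong refl) (simp add: if_distrib[of "\<lambda>x. _ * x"] cong: if_cong)
  also have "\<dots> = (\<Sum>i<?k. \<Sum>k<?k. N i k * (\<Sum>j<?m. P k j * Q j i))"
    by (intro sum.cong refl) (simp add: PQ)
  also have "\<dots> = (\<Sum>i<?k. \<Sum>k<?k. \<Sum>j<?m. N i k * P k j * Q j i)"
    by (simp add: sum_distrib_left mult.assoc)
  also have "\<dots> = (\<Sum>i<?k. \<Sum>j<?m. \<Sum>k<?k. N i k * P k j * Q j i)"
    by (intro sum.cong refl sum.swap)
  also have "\<dots> = (\<Sum>i<?k. \<Sum>j<?m. (\<Sum>k<?k. N i k * P k j) * Q j i)"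
    by (simp add: sum_distrib_right)
  also have "\<dots> = (\<Sum>i<?k. \<Sum>j<?m. (\<Sum>l<?m. P i l * M l j) * Q j i)"
    by (intro sum.cong refl) (simp add: NP)
  also have "\<dots> = (\<Sum>i<?k. \<Sum>j<?m. \<Sum>l<?m. M l j * (Q j i * P i l))"
    by (simp add: sum_distrib_right sum_distrib_left mult_ac)
  also have "\<dots> = (\<Sum>j<?m. \<Sum>i<?k. \<Sum>l<?m. M l j * (Q j i * P i l))"
    by (rule sum.swap)
  also have "\<dots> = (\<Sum>j<?m. \<Sum>l<?m. \<Sum>i<?k. M l j * (Q j i * P i l))"
    by (intro sum.cong refl sum.swap)
  also have "\<dots> = (\<Sum>j<?m. \<Sum>l<?m. M l j * (if l = j then 1 else 0))"
    unfolding sum_distrib_left[symmetric] by (intro sum.cong refl) (simp add: QP)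
  also have "\<dots> = t"
    unfolding t by (intro sum.cong refl) (simp add: if_distrib[of "\<lambda>x. _ * x"] cong: if_cong)
  finally show ?thesis by simp
qed

section \<open>Existence, additivity and transport of traces\<close>

lemma lincomb_Nil [simp]: "lincomb a [] = (\<lambda>_. 0)"
  by (simp add: lincomb_def)

lemma lincomb_Cons: "lincomb a (b # bs) = (\<lambda>x. a 0 * b x + lincomb (\<lambda>i. a (Suc i)) bs x)"
  by (simp add: lincomb_def fun_eq_iff sum.lessThan_Suc_shift del: sum.lessThan_Suc)

lemma lincomb_append:
  "lincomb a (bs @ cs) = (\<lambda>x. lincomb a bs x + lincomb (\<lambda>i. a (length bs + i)) cs x)"
  by (induction bs arbitrary: a) (simp_all add: lincomb_Cons fun_eq_iff)

text \<open>Elimination of one coordinate \<open>p\<close> at a time. If an element of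
  \<open>B\<close> is nonzero at \<open>p\<close>, the subspaces vanishing at \<open>p\<close> have
  the same quotient. Otherwise an element of \<open>Z\<close> that is nonzero at \<open>p\<close>
  adds one basis vector, and if there is none, nothing changes.\<close>

lemma basis_mod_exists:
  assumes "finite A" "lin_subspace Z" "lin_subspace B" "B \<subseteq> Z" "\<And>z x. z \<in> Z \<Longrightarrow> x \<notin> A \<Longrightarrow> z x = 0"
  shows "\<exists>bs. basis_mod bs Z B"
  using assms
proof (induction A arbitrary: Z B rule: finite_induct)
  case empty
  then have "z = (\<lambda>_. 0)" if "z \<in> Z" for z using that by auto
  then have "basis_mod [] Z B"
    using lin_subspace_zero[OF empty.prems(2)] by (auto simp: basis_mod_def cong_mod_def)
  then show ?case ..
next
  case (insert p A)
  note Z = insert.prems(1) and B = insert.prems(2) and BZ = insert.prems(3)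
  let ?Z = "{z \<in> Z. z p = 0}" and ?B = "{z \<in> B. z p = 0}"
  have "\<exists>bs. basis_mod bs ?Z ?B"
  proof (rule insert.IH)
    show "lin_subspace ?Z" "lin_subspace ?B" using Z B by (auto simp: lin_subspace_def)
    show "?B \<subseteq> ?Z" using BZ by blast
    show "z x = 0" if "z \<in> ?Z" "x \<notin> A" for z x
      using that insert.prems(4)[of z x] by (cases "x = p") auto
  qed
  then obtain bs where basis: "basis_mod bs ?Z ?B" ..
  then have bs: "set bs \<subseteq> ?Z" "\<And>a i. lincomb a bs \<in> ?B \<Longrightarrow> i < length bs \<Longrightarrow> a i = 0"
    "\<And>z. z \<in> ?Z \<Longrightarrow> \<exists>a. cong_mod ?B z (lincomb a bs)"
    unfolding basis_mod_def by blast+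
  have at_p: "lincomb a bs p = 0" for a
  proof -
    have "(bs ! i) p = 0" if "i < length bs" for i using bs(1) nth_mem[OF that] by blast
    then show ?thesis unfolding lincomb_def by simp
  qed
  \<comment> \<open>Subtracting a multiple of the pivot \<open>w\<close> clears the coordinate
    \<open>p\<close>.\<close>
  have elim: "(\<lambda>x. z x - z p / w p * w x) \<in> ?Z" if "z \<in> Z" "w \<in> Z" "w p \<noteq> 0" for z w
    using lin_subspace_diff[OF Z that(1) lin_subspace_scale[OF Z that(2), of "z p / w p"]] that(3) by simp
  show ?case
  proof (cases "\<exists>w\<in>B. w p \<noteq> 0")
    case True
    then obtain w where w: "w \<in> B" "w p \<noteq> 0" by blast
    have "basis_mod bs Z B"
      unfolding basis_mod_def
    proof (intro conjI allI impI ballI)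
      show "set bs \<subseteq> Z" using bs(1) by blast
      show "a i = 0" if "lincomb a bs \<in> B" "i < length bs" for a i
        using bs(2)[of a i] that at_p by simp
      fix z assume z: "z \<in> Z"
      obtain a where "cong_mod ?B (\<lambda>x. z x - z p / w p * w x) (lincomb a bs)"
        using bs(3)[OF elim[OF z subsetD[OF BZ w(1)] w(2)]] by blast
      then have "(\<lambda>x. z x - z p / w p * w x - lincomb a bs x) \<in> B" by (simp add: cong_mod_def)
      from lin_subspace_add[OF B this lin_subspace_scale[OF B w(1), of "z p / w p"]]
      have "cong_mod B z (lincomb a bs)" by (simp add: cong_mod_def)
      then show "\<exists>a. cong_mod B z (lincomb a bs)" by (rule exI[of _ a])
    qed
    then show ?thesis ..
  next
    case False
    then have Bp: "b p = 0" if "b \<in> B" for b using that by blast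
    then have B_eq: "?B = B" by blast
    show ?thesis
    proof (cases "\<exists>w\<in>Z. w p \<noteq> 0")
      case True
      then obtain w where w: "w \<in> Z" "w p \<noteq> 0" by blast
      have "basis_mod (w # bs) Z B"
        unfolding basis_mod_def
      proof (intro conjI allI impI ballI)
        show "set (w # bs) \<subseteq> Z" using bs(1) w by auto
        show "a i = 0" if a: "lincomb a (w # bs) \<in> B" and i: "i < length (w # bs)" for a i
        proof -
          have a0: "a 0 = 0" using Bp[OF a] w(2) at_p by (simp add: lincomb_Cons)
          then have "lincomb (\<lambda>i. a (Suc i)) bs \<in> ?B" using a B_eq by (simp add: lincomb_Cons)
          from bs(2)[OF this] a0 i show ?thesis by (cases i) auto
        qed
        fix z assume z: "z \<in> Z"
        obtain a where a: "cong_mod B (\<lambda>x. z x - z p / w p * w x) (lincomb a bs)"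
          using bs(3)[OF elim[OF z w]] B_eq by auto
        have "cong_mod B z (lincomb (case_nat (z p / w p) a) (w # bs))"
          using a by (simp add: cong_mod_def lincomb_Cons diff_diff_eq)
        then show "\<exists>a. cong_mod B z (lincomb a (w # bs))" by (rule exI[of _ "case_nat (z p / w p) a"])
      qed
      then show ?thesis ..
    next
      case False
      then have "?Z = Z" by blast
      then have "basis_mod bs Z B" using basis B_eq by simp
      then show ?thesis ..
    qed
  qed
qed

lemma has_trace_exists:
  assumes "finite A" "lin_subspace Z" "lin_subspace B" "B \<subseteq> Z" "\<And>z x. z \<in> Z \<Longrightarrow> x \<notin> A \<Longrightarrow> z x = 0"
    and gZ: "\<And>z. z \<in> Z \<Longrightarrow> g z \<in> Z"
  shows "\<exists>t. has_trace g Z B t"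
proof -
  have "\<exists>bs. basis_mod bs Z B" by (rule basis_mod_exists[OF assms(1-4)]) (rule assms(5))
  then obtain bs where bs: "basis_mod bs Z B" ..
  then have "\<forall>i. \<exists>a. i < length bs \<longrightarrow> cong_mod B (g (bs ! i)) (lincomb a bs)"
    using gZ nth_mem[of _ bs] unfolding basis_mod_def by blast
  then obtain M where "\<And>i. i < length bs \<Longrightarrow> cong_mod B (g (bs ! i)) (lincomb (M i) bs)" by metis
  then show ?thesis using bs unfolding has_trace_def by blast
qed

lemma sum_lessThan_add: "(\<Sum>i<m + k. f i) = (\<Sum>i<m. f i) + (\<Sum>i<k. f (m + i))" for f :: "nat \<Rightarrow> rat"
  by (induction k) (simp_all add: add.assoc)

text \<open>A basis of \<open>Z\<close> modulo \<open>Y\<close> followed by one of \<open>Y\<close>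
  modulo \<open>B\<close> is a basis of \<open>Z\<close> modulo \<open>B\<close>, and
  \<open>g\<close> is block triangular in it.\<close>

lemma has_trace_add:
  assumes Y: "lin_subspace Y" and BY: "B \<subseteq> Y" and YZ: "Y \<subseteq> Z"
    and "has_trace g Z Y t" "has_trace g Y B u"
  shows "has_trace g Z B (t + u)"
proof -
  obtain bs M where bs: "basis_mod bs Z Y" and M: "\<And>i. i < length bs \<Longrightarrow> cong_mod Y (g (bs ! i)) (lincomb (M i) bs)"
    and t: "t = (\<Sum>i<length bs. M i i)"
    using assms(4) unfolding has_trace_def by blast
  obtain cs N where cs: "basis_mod cs Y B" and N: "\<And>i. i < length cs \<Longrightarrow> cong_mod B (g (cs ! i)) (lincomb (N i) cs)"
    and u: "u = (\<Sum>i<length cs. N i i)"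
    using assms(5) unfolding has_trace_def by blast
  let ?m = "length bs"
  \<comment> \<open>The error of an expansion modulo \<open>Y\<close> lies in \<open>Y\<close> and
    is itself expanded in \<open>cs\<close>.\<close>
  have lift: "\<exists>b. cong_mod B z (lincomb (\<lambda>j. if j < ?m then a j else b (j - ?m)) (bs @ cs))"
    if z: "cong_mod Y z (lincomb a bs)" for z a
  proof -
    obtain b where b: "cong_mod B (\<lambda>x. z x - lincomb a bs x) (lincomb b cs)"
      using basis_mod_span[OF cs] z unfolding cong_mod_def[of Y] by blast
    have "lincomb (\<lambda>j. if j < ?m then a j else b (j - ?m)) (bs @ cs) = (\<lambda>x. lincomb a bs x + lincomb b cs x)"
      using lincomb_cong[of bs "\<lambda>j. if j < ?m then a j else b (j - ?m)" a] by (simp add: lincomb_append)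
    then show ?thesis using b by (intro exI[of _ b]) (simp add: cong_mod_def algebra_simps)
  qed
  have "basis_mod (bs @ cs) Z B"
    unfolding basis_mod_def
  proof (intro conjI allI impI ballI)
    show "set (bs @ cs) \<subseteq> Z" using bs cs YZ unfolding basis_mod_def by auto
    show "a i = 0" if a: "lincomb a (bs @ cs) \<in> B" and i: "i < length (bs @ cs)" for a i
    proof -
      let ?b = "\<lambda>i. a (?m + i)"
      have "lincomb ?b cs \<in> Y" using lincomb_in_subspace[OF Y] cs unfolding basis_mod_def by blast
      from lin_subspace_diff[OF Y _ this, of "lincomb a (bs @ cs)"] a BY
      have "lincomb a bs \<in> Y" by (auto simp: lincomb_append)
      then have a0: "\<And>i. i < ?m \<Longrightarrow> a i = 0" using bs unfolding basis_mod_def by blast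
      then have "lincomb a bs = (\<lambda>_. 0)" unfolding lincomb_def by auto
      then have "lincomb ?b cs \<in> B" using a by (simp add: lincomb_append)
      then have "\<And>i. i < length cs \<Longrightarrow> ?b i = 0" using cs unfolding basis_mod_def by blast
      from a0 this[of "i - ?m"] i show ?thesis by (cases "i < ?m") auto
    qed
    fix z assume "z \<in> Z"
    then obtain a where "cong_mod Y z (lincomb a bs)" using bs unfolding basis_mod_def by blast
    from lift[OF this] show "\<exists>a. cong_mod B z (lincomb a (bs @ cs))" by blast
  qed
  moreover have "\<forall>i. \<exists>b. i < ?m \<longrightarrow> cong_mod B (g (bs ! i)) (lincomb (\<lambda>j. if j < ?m then M i j else b (j - ?m)) (bs @ cs))"
    using lift M by blast
  then obtain K where K: "\<And>i. i < ?m \<Longrightarrow>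
      cong_mod B (g (bs ! i)) (lincomb (\<lambda>j. if j < ?m then M i j else K i (j - ?m)) (bs @ cs))" by metis
  \<comment> \<open>The upper rows consist of the blocks \<open>M\<close> and \<open>K\<close>, the
    lower ones of 0 and \<open>N\<close>; \<open>K\<close> does not meet the diagonal.\<close>
  define R where "R i j = (if i < ?m then if j < ?m then M i j else K i (j - ?m)
      else if j < ?m then 0 else N (i - ?m) (j - ?m))" for i j
  have "cong_mod B (g ((bs @ cs) ! i)) (lincomb (R i) (bs @ cs))" if i: "i < length (bs @ cs)" for i
  proof (cases "i < ?m")
    case True
    have "R i = (\<lambda>j. if j < ?m then M i j else K i (j - ?m))" by (simp add: R_def True fun_eq_iff)
    then show ?thesis using K[OF True] True by (simp add: nth_append)
  next
    case False
    have "lincomb (R i) bs = lincomb (\<lambda>_. 0) bs"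
      by (rule lincomb_cong) (simp add: R_def False)
    then have "lincomb (R i) (bs @ cs) = lincomb (N (i - ?m)) cs"
      unfolding lincomb_append by (simp add: R_def False lincomb_def)
    then show ?thesis using N[of "i - ?m"] i False by (simp add: nth_append)
  qed
  moreover have "t + u = (\<Sum>i<length (bs @ cs). R i i)"
    unfolding length_append sum_lessThan_add t u by (simp add: R_def)
  ultimately show ?thesis unfolding has_trace_def by blast
qed

text \<open>\<open>h\<close> induces an isomorphism of \<open>C\<close> modulo its kernel with its
  image, carrying \<open>g\<close> to \<open>g'\<close>; a basis and its matrix are pushed
  forward.\<close>

lemma has_trace_image:
  assumes C: "lin_subspace C" and h: "lin_map h" and g: "\<And>c. c \<in> C \<Longrightarrow> h (g c) = g' (h c)"
    and gC: "\<And>c. c \<in> C \<Longrightarrow> g c \<in> C" and tr: "has_trace g C {c \<in> C. h c = (\<lambda>_. 0)} t"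
  shows "has_trace g' (h ` C) {\<lambda>_. 0} t"
proof -
  let ?K = "{c \<in> C. h c = (\<lambda>_. 0)}"
  obtain bs M where bs: "set bs \<subseteq> C" "\<And>a i. lincomb a bs \<in> ?K \<Longrightarrow> i < length bs \<Longrightarrow> a i = 0"
    "\<And>z. z \<in> C \<Longrightarrow> \<exists>a. cong_mod ?K z (lincomb a bs)"
    and M: "\<And>i. i < length bs \<Longrightarrow> cong_mod ?K (g (bs ! i)) (lincomb (M i) bs)"
    and t: "t = (\<Sum>i<length bs. M i i)"
    using tr unfolding has_trace_def basis_mod_def by blast
  have push: "cong_mod {\<lambda>_. 0} (h z) (lincomb a (map h bs))" if "cong_mod ?K z (lincomb a bs)" for z a
    using that lin_map_diff[OF h, of z "lincomb a bs"] by (simp add: cong_mod_def lin_map_lincomb[OF h])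
  have "basis_mod (map h bs) (h ` C) {\<lambda>_. 0}"
    unfolding basis_mod_def
  proof (intro conjI allI impI ballI)
    show "set (map h bs) \<subseteq> h ` C" using bs(1) by auto
    show "a i = 0" if "lincomb a (map h bs) \<in> {\<lambda>_. 0}" "i < length (map h bs)" for a i
      using bs(2)[of a i] that lincomb_in_subspace[OF C bs(1), of a] by (simp add: lin_map_lincomb[OF h])
    show "\<exists>a. cong_mod {\<lambda>_. 0} z (lincomb a (map h bs))" if "z \<in> h ` C" for z
      using that bs(3) push by blast
  qed
  moreover have "cong_mod {\<lambda>_. 0} (g' (map h bs ! i)) (lincomb (M i) (map h bs))" if "i < length (map h bs)" for i
  proof -
    have i: "i < length bs" using that by simp
    then have "bs ! i \<in> C" using bs(1) nth_mem by blast
    then show ?thesis using push[OF M[OF i]] i by (simp add: g)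
  qed
  ultimately show ?thesis unfolding has_trace_def t by (intro exI[of _ "map h bs"] exI[of _ M]) simp
qed

text \<open>In the basis of indicator functions the coefficients of a function are its
  values.\<close>

lemma has_trace_coordinates:
  fixes m :: "'a \<Rightarrow> 'a \<Rightarrow> rat"
  assumes "finite A" and m: "\<And>s t. s \<in> A \<Longrightarrow> t \<notin> A \<Longrightarrow> m s t = 0"
  shows "has_trace (\<lambda>v t. \<Sum>s\<in>A. v s * m s t) {v. \<forall>s. s \<notin> A \<longrightarrow> v s = 0} {\<lambda>_. 0} (\<Sum>s\<in>A. m s s)"
proof -
  obtain ss where ss: "set ss = A" "distinct ss" using finite_distinct_list[OF assms(1)] by blast
  let ?\<delta> = "\<lambda>s t. if t = s then 1 else 0 :: rat"
  let ?bs = "map ?\<delta> ss"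
  have bij: "bij_betw ((!) ss) {..<length ss} A"
    using bij_betw_nth[OF ss(2) refl] ss(1) by blast
  have coord: "lincomb a ?bs (ss ! i) = a i" if "i < length ss" for a i
  proof -
    have "lincomb a ?bs (ss ! i) = (\<Sum>j<length ss. if j = i then a j else 0)"
      unfolding lincomb_def length_map
      by (rule sum.cong) (use that nth_eq_iff_index_eq[OF ss(2)] in auto)
    then show ?thesis using that by simp
  qed
  have outside: "lincomb a ?bs x = 0" if "x \<notin> A" for a x
    unfolding lincomb_def length_map using that ss(1) by (intro sum.neutral) auto
  have expand: "v = lincomb (\<lambda>i. v (ss ! i)) ?bs" if v: "\<And>s. s \<notin> A \<Longrightarrow> v s = 0" for v
  proof
    fix x
    show "v x = lincomb (\<lambda>i. v (ss ! i)) ?bs x"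
    proof (cases "x \<in> A")
      case True
      then obtain i where "i < length ss" "x = ss ! i" using ss(1) by (auto simp: in_set_conv_nth)
      then show ?thesis by (simp add: coord)
    qed (simp add: outside v)
  qed
  let ?g = "\<lambda>v t. \<Sum>s\<in>A. v s * m s t"
  have "basis_mod ?bs {v. \<forall>s. s \<notin> A \<longrightarrow> v s = 0} {\<lambda>_. 0}"
    unfolding basis_mod_def
  proof (intro conjI allI impI ballI)
    show "set ?bs \<subseteq> {v. \<forall>s. s \<notin> A \<longrightarrow> v s = 0}" using ss(1) by auto
    show "a i = 0" if "lincomb a ?bs \<in> {\<lambda>_. 0}" "i < length ?bs" for a i
      using that coord[of i a] by simp
    fix v :: "'a \<Rightarrow> rat" assume v: "v \<in> {v. \<forall>s. s \<notin> A \<longrightarrow> v s = 0}"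
    show "\<exists>a. cong_mod {\<lambda>_. 0} v (lincomb a ?bs)"
      by (rule exI, rule cong_mod_eqI, rule expand) (use v in simp)
  qed
  moreover have "cong_mod {\<lambda>_. 0} (?g (?bs ! i)) (lincomb (\<lambda>j. m (ss ! i) (ss ! j)) ?bs)" if i: "i < length ?bs" for i
  proof -
    have "ss ! i \<in> A" using i ss(1) by auto
    then have "?g (?bs ! i) = m (ss ! i)"
      using i assms(1) by (auto simp: fun_eq_iff if_distrib[of "\<lambda>x. x * _"] cong: if_cong)
    also have "\<dots> = lincomb (\<lambda>j. m (ss ! i) (ss ! j)) ?bs"
      by (rule expand) (rule m[OF \<open>ss ! i \<in> A\<close>])
    finally show ?thesis by (rule cong_mod_eqI)
  qed
  moreover have "(\<Sum>s\<in>A. m s s) = (\<Sum>i<length ?bs. m (ss ! i) (ss ! i))"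
    using sum.reindex_bij_betw[OF bij, of "\<lambda>s. m s s"] by simp
  ultimately show ?thesis unfolding has_trace_def
    by (intro exI[of _ ?bs] exI[of _ "\<lambda>i j. m (ss ! i) (ss ! j)"]) blast
qed

section \<open>The Hopf trace formula and fixed cubes\<close>

lemma lin_subspace_chains: "lin_subspace (chains X n q)"
  by (auto simp: lin_subspace_def chains_def)

lemma lin_map_matrix: "lin_map (\<lambda>v t. \<Sum>s\<in>A. v s * m s t)"
  by (auto simp: lin_map_def fun_eq_iff algebra_simps sum.distrib sum_distrib_left)

lemma lin_map_bdry: "lin_map (bdry X n q)"
  unfolding bdry_def by (rule lin_map_matrix)

lemma lin_map_fchain: "lin_map (fchain X n f q)"
  unfolding fchain_def by (rule lin_map_matrix)

lemma lin_subspace_kernel: "lin_subspace V \<Longrightarrow> lin_map h \<Longrightarrow> lin_subspace {v \<in> V. h v = (\<lambda>_. 0)}"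
  using lin_map_zero[of h] by (auto simp: lin_subspace_def lin_map_def)

lemma lin_subspace_image:
  assumes "lin_subspace V" "lin_map h"
  shows "lin_subspace (h ` V)"
  unfolding lin_subspace_def
proof (intro conjI ballI allI)
  show "(\<lambda>_. 0) \<in> h ` V"
    using lin_map_zero[OF assms(2)] lin_subspace_zero[OF assms(1)] by (metis image_eqI)
  fix u assume "u \<in> h ` V"
  then obtain u' where u: "u' \<in> V" "u = h u'" by blast
  show "(\<lambda>x. a * u x) \<in> h ` V" for a
    unfolding u(2) lin_map_scale[OF assms(2), symmetric]
    by (rule imageI) (rule lin_subspace_scale[OF assms(1) u(1)])
  fix v assume "v \<in> h ` V"
  then obtain v' where v: "v' \<in> V" "v = h v'" by blast
  show "(\<lambda>x. u x + v x) \<in> h ` V"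
    unfolding u(2) v(2) lin_map_add[OF assms(2), symmetric]
    by (rule imageI) (rule lin_subspace_add[OF assms(1) u(1) v(1)])
qed

lemma lin_subspace_cycles: "lin_subspace (cycles X n q)"
  unfolding cycles_def by (rule lin_subspace_kernel[OF lin_subspace_chains lin_map_bdry])

lemma lin_subspace_boundaries: "lin_subspace (boundaries X n q)"
  unfolding boundaries_def by (rule lin_subspace_image[OF lin_subspace_chains lin_map_bdry])

lemma lin_subspace_zero_space: "lin_subspace {\<lambda>_. 0}"
  by (simp add: lin_subspace_def)

lemma bdry_in_chains: "bdry X n (Suc q) v \<in> chains X n q"
  unfolding chains_def bdry_def
  using bcoef_face_in_cubes(1) by (fastforce intro!: sum.neutral)

lemma fchain_in_chains: "fchain X n f q v \<in> chains X n q"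
  unfolding chains_def fchain_def
  using fcoef_nonzeroD(1) by (fastforce intro!: sum.neutral)

lemma bdry_bdry:
  assumes "finite X"
  shows "bdry X n q (bdry X n (Suc q) v) = (\<lambda>_. 0)"
proof
  fix t
  have "bdry X n q (bdry X n (Suc q) v) t
    = (\<Sum>r\<in>cubes X n q. \<Sum>s\<in>cubes X n (Suc q). v s * (bcoef s r * bcoef r t))"
    by (simp add: bdry_def sum_distrib_right mult.assoc)
  also have "\<dots> = (\<Sum>s\<in>cubes X n (Suc q). \<Sum>r\<in>cubes X n q. v s * (bcoef s r * bcoef r t))"
    by (rule sum.swap)
  also have "\<dots> = (\<Sum>s\<in>cubes X n (Suc q). v s * (\<Sum>r\<in>cubes X n q. bcoef s r * bcoef r t))"
    by (simp only: sum_distrib_left)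
  also have "\<dots> = 0"
    by (intro sum.neutral ballI) (simp add: sum_bcoef_bcoef[OF assms])
  finally show "bdry X n q (bdry X n (Suc q) v) t = 0" .
qed

lemma boundaries_subset_cycles:
  assumes "finite X"
  shows "boundaries X n q \<subseteq> cycles X n q"
  using bdry_in_chains bdry_bdry[OF assms] by (auto simp: boundaries_def cycles_def)

lemma fchain_bdry:
  assumes "c1_continuous X f" "finite X" "\<forall>x\<in>X. length x = n"
  shows "fchain X n f q (bdry X n (Suc q) v) = bdry X n (Suc q) (fchain X n f (Suc q) v)"
proof
  fix t
  have "fchain X n f q (bdry X n (Suc q) v) t
    = (\<Sum>r\<in>cubes X n q. \<Sum>s\<in>cubes X n (Suc q). v s * (bcoef s r * fcoef X n f r t))"
    by (simp add: bdry_def fchain_def sum_distrib_right mult.assoc)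
  also have "\<dots> = (\<Sum>s\<in>cubes X n (Suc q). \<Sum>r\<in>cubes X n q. v s * (bcoef s r * fcoef X n f r t))"
    by (rule sum.swap)
  also have "\<dots> = (\<Sum>s\<in>cubes X n (Suc q). v s * (\<Sum>r\<in>cubes X n q. bcoef s r * fcoef X n f r t))"
    by (simp only: sum_distrib_left)
  also have "\<dots> = (\<Sum>s\<in>cubes X n (Suc q). v s * (\<Sum>w\<in>cubes X n (Suc q). fcoef X n f s w * bcoef w t))"
    by (intro sum.cong refl) (simp add: chain_map_coef[OF assms])
  also have "\<dots> = (\<Sum>s\<in>cubes X n (Suc q). \<Sum>w\<in>cubes X n (Suc q). v s * (fcoef X n f s w * bcoef w t))"
    by (simp only: sum_distrib_left)
  also have "\<dots> = (\<Sum>w\<in>cubes X n (Suc q). \<Sum>s\<in>cubes X n (Suc q). v s * (fcoef X n f s w * bcoef w t))"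
    by (rule sum.swap)
  also have "\<dots> = bdry X n (Suc q) (fchain X n f (Suc q) v) t"
    by (simp add: bdry_def fchain_def sum_distrib_right mult.assoc)
  finally show "fchain X n f q (bdry X n (Suc q) v) t = bdry X n (Suc q) (fchain X n f (Suc q) v) t" .
qed

lemma bdry_0: "bdry X n 0 v = (\<lambda>_. 0)"
proof
  fix t
  have "bcoef s t = 0" if "s \<in> cubes X n 0" for s
    using cubesD(2)[OF that] by (simp add: bcoef_faces)
  then show "bdry X n 0 v t = 0" by (simp add: bdry_def)
qed

lemma cycles_0: "cycles X n 0 = chains X n 0"
  by (simp add: cycles_def bdry_0)

lemma fchain_cycles:
  assumes "c1_continuous X f" "finite X" "\<forall>x\<in>X. length x = n" and v: "v \<in> cycles X n q"
  shows "fchain X n f q v \<in> cycles X n q"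
proof (cases q)
  case 0
  then show ?thesis by (simp add: cycles_0 fchain_in_chains)
next
  case (Suc r)
  have "bdry X n q (fchain X n f q v) = fchain X n f r (bdry X n q v)"
    using fchain_bdry[OF assms(1-3)] Suc by simp
  also have "bdry X n q v = (\<lambda>_. 0)" using v by (simp add: cycles_def)
  finally show ?thesis using lin_map_zero[OF lin_map_fchain] fchain_in_chains by (simp add: cycles_def)
qed

lemma fchain_boundaries:
  assumes "c1_continuous X f" "finite X" "\<forall>x\<in>X. length x = n" and v: "v \<in> boundaries X n q"
  shows "fchain X n f q v \<in> boundaries X n q"
  using v fchain_bdry[OF assms(1-3)] fchain_in_chains by (auto simp: boundaries_def)

text \<open>A cube has at most \<open>n\<close> nondegenerate factors. This ends the telescoping in
  the trace formula: the only boundary in degree \<open>n\<close> is 0.\<close>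

lemma chains_above_dimension: "chains X n (Suc n) = {\<lambda>_. 0}"
proof -
  have "cdim c \<le> n" if "elem_cube n c" for c
    using that length_filter_le[of _ "[0..<length c]"] by (simp add: cdim_def nd_def elem_cube_def)
  then have "cubes X n (Suc n) = {}" by (fastforce simp: cubes_def)
  then show ?thesis by (auto simp: chains_def)
qed

text \<open>The traces on \<open>chains / cycles\<close> in dimension \<open>q + 1\<close> and on \<open>boundaries\<close>
  in dimension \<open>q\<close> agree, so they cancel in the alternating sum.\<close>
lemma cub_lefschetz_eq_chain_traces:
  assumes "c1_continuous X f" "finite X" "\<forall>x\<in>X. length x = n"
  shows "cub_lefschetz X n f = (\<Sum>q\<le>n. (- 1) ^ q * (\<Sum>s\<in>cubes X n q. fcoef X n f s s))"
proof -
  let ?F = "fchain X n f" and ?C = "chains X n" and ?Z = "cycles X n" and ?B = "boundaries X n"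
  let ?c = "\<lambda>q. \<Sum>s\<in>cubes X n q. fcoef X n f s s" and ?h = "hom_trace X n f"
  have ZC: "?Z q \<subseteq> ?C q" for q by (auto simp: cycles_def)
  have BZ: "?B q \<subseteq> ?Z q" for q by (rule boundaries_subset_cycles[OF assms(2)])
  have zero: "{\<lambda>_. 0} \<subseteq> ?B q" for q using lin_subspace_zero[OF lin_subspace_boundaries] by simp
  have F0: "v \<in> {\<lambda>_. 0} \<Longrightarrow> ?F q v \<in> {\<lambda>_. 0}" for v q using lin_map_zero[OF lin_map_fchain] by simp
  have supp: "z x = 0" if "z \<in> ?C q" "x \<notin> cubes X n q" for z x q
    using that by (simp add: chains_def)
  have ex: "\<exists>t. has_trace (?F q) U V t"
    if "lin_subspace U" "lin_subspace V" "V \<subseteq> U" "U \<subseteq> ?C q" "\<And>z. z \<in> U \<Longrightarrow> ?F q z \<in> U" for U V q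
    by (rule has_trace_exists[OF finite_cubes[OF assms(2)] that(1-3)]) (use that(4,5) supp in blast)+
  have "\<exists>t. has_trace (?F q) (?Z q) (?B q) t" for q
    by (rule ex[OF lin_subspace_cycles lin_subspace_boundaries BZ ZC]) (rule fchain_cycles[OF assms])
  \<comment> \<open>Whatever value \<open>SOME\<close> picks is good: it enters only through sums
    that are traces modulo the zero space, and those are unique.\<close>
  then have h: "has_trace (?F q) (?Z q) (?B q) (?h q)" for q
    unfolding hom_trace_def quot_trace_eq_SOME by (rule someI_ex)
  have "\<exists>t. has_trace (?F q) (?B q) {\<lambda>_. 0} t" for q
    by (rule ex[OF lin_subspace_boundaries lin_subspace_zero_space zero order_trans[OF BZ ZC]])
      (rule fchain_boundaries[OF assms])
  then obtain b where b: "\<And>q. has_trace (?F q) (?B q) {\<lambda>_. 0} (b q)" by metis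
  have hb: "has_trace (?F q) (?Z q) {\<lambda>_. 0} (?h q + b q)" for q
    by (rule has_trace_add[OF lin_subspace_boundaries zero BZ h b])
  have c: "has_trace (?F q) (?C q) {\<lambda>_. 0} (?c q)" for q
    unfolding fchain_def chains_def
    by (rule has_trace_coordinates[OF finite_cubes[OF assms(2)]]) (use fcoef_nonzeroD(1) in blast)
  have unique: "t = t'" if "has_trace (?F q) U {\<lambda>_. 0} t" "has_trace (?F q) U {\<lambda>_. 0} t'" for q U t t'
    by (rule has_trace_unique[OF lin_subspace_zero_space lin_map_fchain _ that]) (rule F0)
  \<comment> \<open>In degree 0 all chains are cycles, so no contribution from a lower degree
    appears.\<close>
  have c0: "?c 0 = ?h 0 + b 0"
    by (rule unique[OF c]) (use hb[of 0] in \<open>simp add: cycles_0\<close>)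
  have cSuc: "?c (Suc q) = b q + (?h (Suc q) + b (Suc q))" for q
  proof -
    have "\<exists>t. has_trace (?F (Suc q)) (?C (Suc q)) (?Z (Suc q)) t"
      by (rule ex[OF lin_subspace_chains lin_subspace_cycles ZC order_refl]) (rule fchain_in_chains)
    then obtain t where t: "has_trace (?F (Suc q)) (?C (Suc q)) (?Z (Suc q)) t" ..
    \<comment> \<open>The boundary map identifies chains modulo cycles with its image and commutes
      with the maps induced by \<open>f\<close>.\<close>
    have "has_trace (?F q) (bdry X n (Suc q) ` ?C (Suc q)) {\<lambda>_. 0} t"
      by (rule has_trace_image[OF lin_subspace_chains lin_map_bdry])
        (use fchain_bdry[OF assms] fchain_in_chains t in \<open>simp_all add: cycles_def\<close>)
    then have "t = b q" by (intro unique[OF _ b]) (simp add: boundaries_def)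
    moreover have "has_trace (?F (Suc q)) (?C (Suc q)) {\<lambda>_. 0} (t + (?h (Suc q) + b (Suc q)))"
      by (rule has_trace_add[OF lin_subspace_cycles order_trans[OF zero BZ] ZC t hb])
    ultimately show ?thesis using unique[OF c[of "Suc q"]] by simp
  qed
  \<comment> \<open>Each \<open>b q\<close> occurs in two consecutive degrees with opposite signs,
    so only the last one is left over.\<close>
  have alternating: "(\<Sum>q\<le>m. (- 1) ^ q * ?c q) = (\<Sum>q\<le>m. (- 1) ^ q * ?h q) + (- 1) ^ m * b m" for m
  proof (induction m)
    case 0
    then show ?case by (simp add: c0)
  next
    case (Suc m)
    then show ?case unfolding sum.atMost_Suc cSuc by (simp add: algebra_simps)
  qed
  have "has_trace (?F n) {\<lambda>_. 0} {\<lambda>_. 0} 0"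
    unfolding has_trace_def by (intro exI[of _ "[]"]) (simp add: basis_mod_def cong_mod_def)
  moreover have "?B n = {\<lambda>_. 0}"
    by (simp add: boundaries_def chains_above_dimension lin_map_zero[OF lin_map_bdry])
  ultimately have "b n = 0" by (intro unique[OF b[of n]]) simp
  then show ?thesis using alternating[of n] by (simp add: cub_lefschetz_def)
qed

theorem theorem5p2:
  fixes X :: "int list set" and n k :: nat and f :: "int list \<Rightarrow> int list"
  assumes "n \<le> 4"
    and "finite X"
    and "\<forall>x\<in>X. length x = n"
    and "c1_continuous X f"
    and "\<bar>cub_lefschetz X n f\<bar> = of_nat k"
  shows "k \<le> card {s \<in> all_cubes X n. f ` cpts s = cpts s}"
proof -
  let ?G = "\<lambda>q. {s \<in> cubes X n q. f ` cpts s = cpts s}"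
  let ?A = "{s \<in> all_cubes X n. f ` cpts s = cpts s}"
  have finG: "finite (?G q)" for q using finite_cubes[OF assms(2)] by simp
  \<comment> \<open>Diagonal coefficients are 0, 1 or -1, and a nonzero one requires a cube mapped
    onto itself.\<close>
  have "\<bar>\<Sum>s\<in>cubes X n q. fcoef X n f s s\<bar> \<le> of_nat (card (?G q))" for q
  proof -
    have "\<bar>\<Sum>s\<in>cubes X n q. fcoef X n f s s\<bar> \<le> (\<Sum>s\<in>cubes X n q. \<bar>fcoef X n f s s\<bar>)"
      by (rule sum_abs)
    also have "\<dots> \<le> (\<Sum>s\<in>cubes X n q. if f ` cpts s = cpts s then 1 else 0)"
    proof (rule sum_mono)
      fix s assume s: "s \<in> cubes X n q"
      then show "\<bar>fcoef X n f s s\<bar> \<le> (if f ` cpts s = cpts s then 1 else 0)"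
        using fcoef_cases[OF assms(4) s, of s] fcoef_nonzeroD(2)[OF s, of f s] by auto
    qed
    also have "\<dots> = of_nat (card (?G q))"
      using finite_cubes[OF assms(2), of n q] by (simp add: sum.If_cases Int_def)
    finally show ?thesis .
  qed
  then have "(\<Sum>q\<le>n. \<bar>(- 1) ^ q * (\<Sum>s\<in>cubes X n q. fcoef X n f s s)\<bar>) \<le> (\<Sum>q\<le>n. of_nat (card (?G q)))"
    by (intro sum_mono) (simp add: abs_mult power_abs)
  moreover have "of_nat k \<le> (\<Sum>q\<le>n. \<bar>(- 1) ^ q * (\<Sum>s\<in>cubes X n q. fcoef X n f s s)\<bar>)"
    unfolding assms(5)[symmetric] cub_lefschetz_eq_chain_traces[OF assms(4,2,3)] by (rule sum_abs)
  ultimately have "(of_nat k :: rat) \<le> of_nat (\<Sum>q\<le>n. card (?G q))" by simp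
  then have "k \<le> (\<Sum>q\<le>n. card (?G q))" by (simp only: of_nat_le_iff)
  \<comment> \<open>Fixed cubes of different dimensions are distinct, so the counts add up.\<close>
  also have "\<dots> = card (\<Union>q\<le>n. ?G q)"
    using finG by (intro card_UN_disjoint[symmetric]) (auto simp: cubes_def)
  also have "\<dots> \<le> card ?A"
  proof (rule card_mono)
    show "finite ?A" using finite_all_cubes[OF assms(2), of n] by simp
  qed (auto simp: cubes_def all_cubes_def)
  finally show ?thesis .
qed

end
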